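(* Let $(x_j)_{j\ge 1}$, $(q_j)_{j\ge 0}$ be the samples and sampling policies of an adaptive importance sampling scheme for the integrand $\varphi:\mathbb R^d\to\mathbb R^p$, with estimates $I_n = n^{-1}\sum_{j=1}^n \varphi(x_j)/q_{j-1}(x_j)$ (see context). Assume that $$V(q_n,\varphi)\to V_*\quad\text{almost surely as } n\to\infty$$ for some (deterministic) $V_*\ge 0$ (a symmetric positive semidefinite $p\times p$ matrix), and that there exists $\eta>0$ such that $$\sup_{j\in\mathbb N}\int \frac{\|\varphi(x)\|^{2+\eta}}{q_j(x)^{1+\eta}}\,dx<\infty\quad\text{almost surely.}$$ Then, as $n\to\infty$, $$\sqrt n\,\Big(I_n-\int\varphi\Big)\longrightarrow \mathcal N(0,V_* )\quad\text{in distribution.}$$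
   Context: Integrals are with respect to Lebesgue measure on $\mathbb R^d$; $\|\cdot\|$ is the Euclidean norm; $\mathbb N=\{0,1,2,\dots\}$, $\mathbb N^*=\{1,2,\dots\}$. The integrand $\varphi=(\varphi_1,\dots,\varphi_p):\mathbb R^d\to\mathbb R^p$ is measurable and integrable. Adaptive importance sampling (AIS), at the sample scale: an allocation policy $(n_t)_{t\ge1}\subset\mathbb N^*$ is given, and $N_t=\sum_{s=1}^t n_s$ (no growth condition on $(n_t)$). An initial probability density $q_0$ on $\mathbb R^d$ is given. Let $\mathscr F_n=\sigma(x_1,\dots,x_n)$, with $\mathscr F_0$ trivial. For $j=1,2,\dots$: conditionally on $\mathscr F_{j-1}$, $x_j$ has probability density $q_{j-1}$; then $q_j$ is a (random) probability density on $\mathbb R^d$ that is $\mathscr F_j$-measurable, with $q_j=q_{j-1}$ unless $j\in\{N_t: t\ge1\}$ (the update rule is otherwise arbitrary). The estimate is $I_n=n^{-1}\sum_{j=1}^n\varphi(x_j)/q_{j-1}(x_j)$. For a probability density $q$, $$V(q,\varphi)=\int\frac{\big(\varphi(x)-q(x)\int\varphi\big)\big(\varphi(x)-q(x)\int\varphi\big)^T}{q(x)}\,dx.$$ In quotients by $q$, the convention is $0/0=0$ and $a/0=\infty$ for $a>0$ (so finiteness of the integrals in the assumptions entails that $q_j>0$ almost everywhere on $\{\varphi\neq0\}$). *)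

theory Defs
  imports "HOL-Probability.Probability"
begin

section \<open>Adaptive importance sampling\<close>

definition prob_density :: "(real ^ 'd \<Rightarrow> real) \<Rightarrow> bool" where
  "prob_density q \<longleftrightarrow>
     q \<in> borel_measurable borel \<and> (\<forall>y. 0 \<le> q y) \<and> (\<integral>\<^sup>+ y. ennreal (q y) \<partial>lborel) = 1"

definition sample_algebra ::
    "'w measure \<Rightarrow> (nat \<Rightarrow> 'w \<Rightarrow> real ^ 'd) \<Rightarrow> nat \<Rightarrow> 'w measure" where
  "sample_algebra M x n =
     sigma (space M) {x j -` A \<inter> space M | j A. j \<in> {1..n} \<and> A \<in> sets borel}"

text \<open>
  Samples are \<open>x 1, x 2, \<dots>\<close> (the value \<open>x 0\<close> is unconstrained and never used), policies are
  \<open>q 0, q 1, \<dots>\<close>, and \<open>alloc t\<close>, for \<open>t \<ge> 1\<close>, is the number of draws in stage \<open>t\<close>.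
  Measurability of the random function \<open>q j\<close> with respect to the past is joint measurability in
  the sample point and the argument. For \<open>j = 0\<close> the past is trivial, hence \<open>q 0\<close> is
  deterministic; see \<open>initial_density_deterministic\<close> below.
\<close>

locale adaptive_importance_sampling = prob_space M
  for M :: "'w measure" +
  fixes alloc :: "nat \<Rightarrow> nat"
    and q :: "nat \<Rightarrow> 'w \<Rightarrow> real ^ 'd \<Rightarrow> real"
    and x :: "nat \<Rightarrow> 'w \<Rightarrow> real ^ 'd"
  assumes alloc_pos: "\<And>t. 1 \<le> t \<Longrightarrow> 1 \<le> alloc t"
    and sample_measurable: "\<And>j. 1 \<le> j \<Longrightarrow> x j \<in> borel_measurable M"
    and policy_density: "\<And>j \<omega>. \<omega> \<in> space M \<Longrightarrow> prob_density (q j \<omega>)"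
    and policy_measurable:
      "\<And>j. (\<lambda>(\<omega>, y). q j \<omega> y) \<in> borel_measurable (sample_algebra M x j \<Otimes>\<^sub>M borel)"
    and policy_update:
      "\<And>j \<omega>. 1 \<le> j \<Longrightarrow> j \<notin> {(\<Sum>s=1..t. alloc s) | t. 1 \<le> t} \<Longrightarrow> \<omega> \<in> space M \<Longrightarrow>
         q j \<omega> = q (j - 1) \<omega>"
    and sample_cond_density:
      "\<And>j A. 1 \<le> j \<Longrightarrow> A \<in> sets borel \<Longrightarrow>
         AE \<omega> in M. real_cond_exp M (sample_algebra M x (j - 1)) (\<lambda>\<omega>'. indicator A (x j \<omega>')) \<omega>
                    = (LINT y:A|lborel. q (j - 1) \<omega> y)"

lemma (in adaptive_importance_sampling) initial_density_deterministic:
  assumes "\<omega> \<in> space M" "\<omega>' \<in> space M"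
  shows "q 0 \<omega> = q 0 \<omega>'"
proof
  fix y :: "real ^ 'd"
  let ?F = "sample_algebra M x 0"
  have sp: "space ?F = space M" and st: "sets ?F = {{}, space M}"
    by (auto simp: sample_algebra_def sigma_sets_empty_eq)
  have "(\<lambda>\<omega>. (\<omega>, y)) \<in> ?F \<rightarrow>\<^sub>M ?F \<Otimes>\<^sub>M borel"
    by simp
  from measurable_compose[OF this policy_measurable[of 0]]
  have "(\<lambda>\<omega>. q 0 \<omega> y) \<in> borel_measurable ?F"
    by simp
  then have "(\<lambda>\<omega>. q 0 \<omega> y) -` {q 0 \<omega> y} \<inter> space ?F \<in> sets ?F"
    by (rule measurable_sets) simp
  with assms(1) have "(\<lambda>\<omega>. q 0 \<omega> y) -` {q 0 \<omega> y} \<inter> space M = space M"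
    by (auto simp: sp st)
  with assms(2) show "q 0 \<omega> y = q 0 \<omega>' y"
    by (metis IntD1 vimage_singleton_eq)
qed

text \<open>
  Here \<open>a / 0 = 0\<close> for real \<open>a\<close>. This is immaterial, since \<open>q (j - 1) \<omega> (x j \<omega>) > 0\<close> almost surely.
\<close>

definition ais_estimate ::
    "(nat \<Rightarrow> 'w \<Rightarrow> real ^ 'd \<Rightarrow> real) \<Rightarrow> (nat \<Rightarrow> 'w \<Rightarrow> real ^ 'd) \<Rightarrow> (real ^ 'd \<Rightarrow> real ^ 'p)
      \<Rightarrow> nat \<Rightarrow> 'w \<Rightarrow> real ^ 'p" where
  "ais_estimate q x \<phi> n \<omega> =
     (1 / real n) *\<^sub>R (\<Sum>j=1..n. (1 / q (j - 1) \<omega> (x j \<omega>)) *\<^sub>R \<phi> (x j \<omega>))"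

text \<open>
  Again \<open>a / 0 = 0\<close>, so these entries are the intended ones when \<open>q > 0\<close> almost everywhere on
  \<open>{\<phi> \<noteq> 0}\<close> and \<open>\<parallel>\<phi>\<parallel>\<^sup>2 / q\<close> is integrable. Both follow, by Jensen's inequality, from finiteness
  of the quantity \<open>ais_moment \<eta> q \<phi>\<close> defined below, for any \<open>\<eta> > 0\<close>.
\<close>

definition ais_variance ::
    "(real ^ 'd \<Rightarrow> real) \<Rightarrow> (real ^ 'd \<Rightarrow> real ^ 'p) \<Rightarrow> real ^ 'p ^ 'p" where
  "ais_variance q \<phi> =
     (let I = (LINT z|lborel. \<phi> z) in
      \<chi> i k. LINT y|lborel. (\<phi> y $ i - q y * I $ i) * (\<phi> y $ k - q y * I $ k) / q y)"

text \<open>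
  Division in \<^typ>\<open>ennreal\<close> satisfies \<open>0 / 0 = 0\<close> and \<open>a / 0 = \<infinity>\<close> for \<open>a > 0\<close>.
\<close>

definition ais_moment ::
    "real \<Rightarrow> (real ^ 'd \<Rightarrow> real) \<Rightarrow> (real ^ 'd \<Rightarrow> real ^ 'p) \<Rightarrow> ennreal" where
  "ais_moment \<eta> q \<phi> =
     (\<integral>\<^sup>+ y. ennreal (norm (\<phi> y) powr (2 + \<eta>)) / ennreal (q y powr (1 + \<eta>)) \<partial>lborel)"


section \<open>Convergence in distribution to a multivariate normal law\<close>

definition pos_semidef :: "real ^ 'p ^ 'p \<Rightarrow> bool" where
  "pos_semidef V \<longleftrightarrow> transpose V = V \<and> (\<forall>u. 0 \<le> u \<bullet> (V *v u))"

definition std_normal_vec :: "(real ^ 'p) measure" where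
  "std_normal_vec = density lborel (\<lambda>z. ennreal (\<Prod>i\<in>UNIV. std_normal_density (z $ i)))"

text \<open>
  The law of \<open>\<mu> + A Z\<close> with \<open>Z\<close> standard normal and \<open>A A\<^sup>T = V\<close>. Such \<open>A\<close> exists for every positive
  semidefinite \<open>V\<close>, singular ones included, and the law depends on \<open>A\<close> only through \<open>A A\<^sup>T\<close>,
  so the choice made by \<open>SOME\<close> does not matter.
\<close>

definition normal_vec :: "real ^ 'p \<Rightarrow> real ^ 'p ^ 'p \<Rightarrow> (real ^ 'p) measure" where
  "normal_vec \<mu> V =
     distr std_normal_vec borel (\<lambda>z. \<mu> + (SOME A :: real ^ 'p ^ 'p. A ** transpose A = V) *v z)"

text \<open>
  The library has weak convergence only for measures on the real line (\<^const>\<open>weak_conv_m\<close>).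
\<close>

definition converges_in_distribution ::
    "'w measure \<Rightarrow> (nat \<Rightarrow> 'w \<Rightarrow> 'b::topological_space) \<Rightarrow> 'b measure \<Rightarrow> bool" where
  "converges_in_distribution M X N \<longleftrightarrow>
     (\<forall>f :: 'b \<Rightarrow> real. continuous_on UNIV f \<and> bounded (range f) \<longrightarrow>
        (\<lambda>n. LINT y|distr M borel (X n). f y) \<longlonglongrightarrow> (LINT y|N. f y))"

end

theory Submission
  imports Defs
begin

text \<open>
  By the multivariate Levy continuity theorem it suffices to treat the characteristic function at
  a vector \<open>w\<close>. Put \<open>s = w \<bullet> V w\<close>. Conditionally on the past, the summand
  \<open>w \<bullet> (\<phi>(x) / q(x) - \<integral>\<phi>) / \<surd>n\<close> is centred with variance \<open>w \<bullet> V(q, \<phi>) w / n\<close>, so by the moment bound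
  its conditional characteristic function is \<open>1 - w \<bullet> V(q, \<phi>) w / (2n)\<close> up to an error of order
  \<open>n powr (- 1 - \<delta> / 2)\<close>. As \<open>exp (- s / (2n))\<close> is deterministic, the conditional factors can be exchanged
  for it one by one, at a total cost bounded by the Cesaro mean of the expectations of
  \<open>\<bar>w \<bullet> V(q, \<phi>) w - s\<bar>\<close>, which tends to 0. To have uniform bounds, all this is done for the summands up to
  the first time that a moment exceeds \<open>K\<close>, and \<open>K \<rightarrow> \<infinity>\<close> at the end.
\<close>

section \<open>The multivariate normal law\<close>

text \<open>Conditioning is dealt with once: \<open>distr_sample_eq_density\<close> identifies the
  joint law of the past and the next sample as a density. From then on conditional characteristic
  functions are ordinary integrals against \<open>q k \<omega>\<close>, and Fubini's theorem
  replaces conditional expectation. The obstacle is that the moments are bounded by a random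
  constant, while dominated convergence and the Taylor remainder ask for a deterministic one.
  Restricting to the event that all moments stay below K would look into the future and destroy the
  centring. The truncation used here tests only \<open>q 0\<close>, ..., \<open>q k\<close> before
  the draw \<open>x (Suc k)\<close>, so a draw is kept or dropped by the past alone and the
  conditional expansion survives. The exchange of factors divides neither by a conditional
  characteristic function nor by a variance, so V may be singular. The exponent \<delta> is
  \<open>min 1 \<eta>\<close> because the Taylor remainder after the quadratic term is at most
  cubic.\<close>

lemma quadratic_form_add_axis:
  fixes V :: "real ^ 'p ^ 'p"
  assumes sym: "transpose V = V"
  shows "(u + t *\<^sub>R axis m 1) \<bullet> (V *v (u + t *\<^sub>R axis m 1)) =
    u \<bullet> (V *v u) + 2 * t * (V *v u) $ m + t\<^sup>2 * V $ m $ m"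
proof -
  have 1: "u \<bullet> (V *v axis m 1) = (V *v u) $ m"
    by (metis cart_eq_inner_axis dot_lmul_matrix inner_commute matrix_vector_mul_component sym
        transpose_matrix_vector)
  have 2: "axis m 1 \<bullet> (V *v w) = (V *v w) $ m" for w :: "real ^ 'p"
    by (metis cart_eq_inner_axis inner_commute)
  have 3: "(V *v axis m 1) $ m = V $ m $ m"
    by (simp add: matrix_vector_mul_component inner_axis)
  show ?thesis
    by (simp add: matrix_vector_right_distrib matrix_vector_mult_scaleR inner_add_left
        inner_add_right 1 2 3 power2_eq_square algebra_simps)
qed

text \<open>
  Elimination of one index at a time: if \<open>V $ m $ m > 0\<close>, subtracting the outer product of the row \<open>m\<close>
  with itself, divided by \<open>V $ m $ m\<close>, leaves a positive semidefinite matrix without the index \<open>m\<close>;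
  if \<open>V $ m $ m = 0\<close>, the whole row vanishes.
\<close>

lemma psd_eq_sum_outer_products:
  fixes V :: "real ^ 'p ^ 'p"
  assumes "finite I" "transpose V = V" "\<And>u. 0 \<le> u \<bullet> (V *v u)"
    and "\<And>i j. V $ i $ j \<noteq> 0 \<Longrightarrow> i \<in> I \<and> j \<in> I"
  shows "\<exists>a :: 'p \<Rightarrow> 'p \<Rightarrow> real. \<forall>i j. V $ i $ j = (\<Sum>k\<in>I. a k i * a k j)"
  using assms
proof (induction I arbitrary: V rule: finite_induct)
  case empty
  then show ?case by auto
next
  case (insert m I)
  note sym = insert.prems(1) and psd = insert.prems(2)
  define r where "r = V $ m $ m"
  have symD: "V $ i $ j = V $ j $ i" for i j
    using arg_cong[OF sym, of "\<lambda>X. X $ j $ i"] by (simp add: transpose_def)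
  \<comment> \<open>On the line through u in direction \<open>axis m 1\<close> the form is a
    quadratic polynomial in t that is nowhere negative. Each choice of t below extracts one
    inequality from it.\<close>
  have ineq: "0 \<le> u \<bullet> (V *v u) + 2 * t * (V *v u) $ m + t\<^sup>2 * r" for u t
    using psd[of "u + t *\<^sub>R axis m 1"] unfolding quadratic_form_add_axis[OF sym] r_def .
  have r_nonneg: "0 \<le> r"
    using ineq[of 0 1] by simp
  show ?case
  proof (cases "r = 0")
    case True
    have z: "V $ m $ j = 0" for j
    proof (rule ccontr)
      assume ne: "V $ m $ j \<noteq> 0"
      let ?c = "V $ m $ j" and ?b = "axis j 1 \<bullet> (V *v axis j 1)"
      have c: "(V *v axis j 1) $ m = ?c"
        by (simp add: matrix_vector_mul_component inner_axis)
      \<comment> \<open>With \<open>r = 0\<close> the polynomial is affine in t, so a nonzero slope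
        would make it negative somewhere; this t gives the value -1.\<close>
      have "0 \<le> ?b + 2 * (- (?b + 1) / (2 * ?c)) * ?c"
        using ineq[of "axis j 1" "- (?b + 1) / (2 * ?c)"] True unfolding c by simp
      also have "\<dots> = -1"
        using ne by (simp add: field_simps)
      finally show False by simp
    qed
    have "\<exists>a :: 'p \<Rightarrow> 'p \<Rightarrow> real. \<forall>i j. V $ i $ j = (\<Sum>k\<in>I. a k i * a k j)"
    proof (rule insert.IH[OF sym psd])
      fix i j assume ne: "V $ i $ j \<noteq> 0"
      then show "i \<in> I \<and> j \<in> I"
        using insert.prems(3)[OF ne] z symD by (metis insertE)
    qed
    then obtain a :: "'p \<Rightarrow> 'p \<Rightarrow> real" where a: "\<forall>i j. V $ i $ j = (\<Sum>k\<in>I. a k i * a k j)" ..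
    have "\<forall>i j. V $ i $ j = (\<Sum>k\<in>insert m I. (a(m := \<lambda>_. 0)) k i * (a(m := \<lambda>_. 0)) k j)"
      using a insert.hyps by (auto intro!: sum.cong)
    then show ?thesis by blast
  next
    case False
    then have r: "0 < r" using r_nonneg by simp
    define W :: "real ^ 'p ^ 'p" where "W = (\<chi> i j. V $ i $ j - V $ m $ i * V $ m $ j / r)"
    have "\<exists>a :: 'p \<Rightarrow> 'p \<Rightarrow> real. \<forall>i j. W $ i $ j = (\<Sum>k\<in>I. a k i * a k j)"
    proof (rule insert.IH)
      show "transpose W = W"
        by (simp add: W_def transpose_def vec_eq_iff symD mult.commute)
      show "0 \<le> u \<bullet> (W *v u)" for u
      proof -
        define s where "s = (V *v u) $ m"
        have s: "s = (\<Sum>j\<in>UNIV. V $ m $ j * u $ j)"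
          by (simp add: s_def matrix_vector_mult_def)
        have "u \<bullet> (W *v u) = u \<bullet> (V *v u) - s * s / r"
          by (simp add: inner_vec_def matrix_vector_mult_def W_def s algebra_simps
              sum_subtractf sum_distrib_left sum_distrib_right sum_divide_distrib)
        \<comment> \<open>\<open>t = - s / r\<close> is the minimiser of the polynomial, and the
          minimum is the quadratic form of W.\<close>
        also have "\<dots> = u \<bullet> (V *v u) + 2 * (- s / r) * (V *v u) $ m + (- s / r)\<^sup>2 * r"
          using r by (simp add: s_def[symmetric] field_simps power2_eq_square)
        also have "\<dots> \<ge> 0" by (rule ineq)
        finally show ?thesis .
      qed
      show "i \<in> I \<and> j \<in> I" if "W $ i $ j \<noteq> 0" for i j
      proof -
        have "i \<noteq> m" "j \<noteq> m"
          using that r by (auto simp: W_def r_def symD)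
        moreover have "V $ i $ j \<noteq> 0 \<or> V $ m $ i \<noteq> 0 \<and> V $ m $ j \<noteq> 0"
          using that by (auto simp: W_def)
        ultimately show ?thesis
          using insert.prems(3) by blast
      qed
    qed
    then obtain a :: "'p \<Rightarrow> 'p \<Rightarrow> real" where a: "\<forall>i j. W $ i $ j = (\<Sum>k\<in>I. a k i * a k j)" ..
    define b where "b = a(m := \<lambda>i. V $ m $ i / sqrt r)"
    have "V $ i $ j = (\<Sum>k\<in>insert m I. b k i * b k j)" for i j
    proof -
      have "(\<Sum>k\<in>I. b k i * b k j) = W $ i $ j"
        using a insert.hyps by (auto simp: b_def intro!: sum.cong)
      then show ?thesis
        using insert.hyps r by (simp add: b_def W_def)
    qed
    then show ?thesis by blast
  qed
qed

text \<open>The vectors of the outer product decomposition become the columns of A. It guarantees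
  that the \<open>SOME\<close> in \<open>normal_vec\<close> picks an actual factor of V.\<close>

lemma pos_semidef_square_root:
  fixes V :: "real ^ 'p ^ 'p"
  assumes "pos_semidef V"
  shows "\<exists>A :: real ^ 'p ^ 'p. A ** transpose A = V"
proof -
  obtain a :: "'p \<Rightarrow> 'p \<Rightarrow> real" where a: "\<forall>i j. V $ i $ j = (\<Sum>k\<in>UNIV. a k i * a k j)"
    using psd_eq_sum_outer_products[of UNIV V] assms by (auto simp: pos_semidef_def)
  have "(\<chi> i k. a k i) ** transpose (\<chi> i k. a k i) = V"
    by (simp add: matrix_matrix_mult_def transpose_def vec_eq_iff a)
  then show ?thesis ..
qed

section \<open>Characteristic function of the normal law\<close>

text \<open>\<open>std_normal_vec\<close> multiplies over coordinates, whereas \<open>lborel\<close>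
  is a product measure over \<open>Basis\<close>. The argument u carries the frequency, as the
  density and the exponential factor over the same coordinates.\<close>

lemma prod_UNIV_vec_eq_prod_Basis:
  fixes z u :: "real ^ 'p"
  shows "(\<Prod>i\<in>UNIV. g (z $ i) (u $ i)) = (\<Prod>b\<in>Basis. g (z \<bullet> b) (u \<bullet> b))"
proof -
  have "bij_betw (\<lambda>i :: 'p. axis i (1 :: real)) UNIV Basis"
    by (auto simp: bij_betw_def inj_on_def axis_eq_axis Basis_vec_def)
  from prod.reindex_bij_betw[OF this, of "\<lambda>b. g (z \<bullet> b) (u \<bullet> b)"]
  show ?thesis
    by (simp add: inner_axis)
qed

lemma std_normal_vec_eq:
  "(std_normal_vec :: (real ^ 'p) measure) =
    density lborel (\<lambda>z. \<Prod>b\<in>Basis. ennreal (std_normal_density (z \<bullet> b)))"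
  unfolding std_normal_vec_def
  by (simp add: prod_ennreal prod_UNIV_vec_eq_prod_Basis[of "\<lambda>a _. std_normal_density a"])

lemma sets_std_normal_vec [measurable_cong, simp]: "sets std_normal_vec = sets borel"
  and space_std_normal_vec [simp]: "space std_normal_vec = UNIV"
  by (simp_all add: std_normal_vec_def)

lemma prob_space_std_normal_vec: "prob_space (std_normal_vec :: (real ^ 'p) measure)"
proof
  have "emeasure (std_normal_vec :: (real ^ 'p) measure) (space std_normal_vec) =
      (\<integral>\<^sup>+z. (\<Prod>b\<in>(Basis :: (real ^ 'p) set). ennreal (std_normal_density (z \<bullet> b))) \<partial>lborel)"
    unfolding std_normal_vec_eq by (simp add: emeasure_density)
  also have "\<dots> = (\<Prod>b\<in>(Basis :: (real ^ 'p) set). \<integral>\<^sup>+t. ennreal (std_normal_density t) \<partial>lborel)"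
    by (rule nn_integral_lborel_prod) auto
  also have "(\<integral>\<^sup>+t. ennreal (std_normal_density t) \<partial>lborel) = 1"
    using prob_space.emeasure_space_1[OF prob_space_normal_density[of 1 0]]
    by (simp add: emeasure_density)
  finally show "emeasure (std_normal_vec :: (real ^ 'p) measure) (space std_normal_vec) = 1"
    by simp
qed

lemma char_std_normal_vec:
  fixes u :: "real ^ 'p"
  shows "(CLINT z|std_normal_vec. iexp (u \<bullet> z)) = complex_of_real (exp (- (norm u)\<^sup>2 / 2))"
proof -
  interpret P: product_sigma_finite "\<lambda>_ :: real ^ 'p. lborel :: real measure"
    by standard
  let ?g = "\<lambda>a t. complex_of_real (std_normal_density a) * iexp (t * a)"
  have 1: "complex_of_real (\<Prod>i\<in>UNIV. std_normal_density (z $ i)) * iexp (u \<bullet> z) =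
      (\<Prod>b\<in>Basis. ?g (z \<bullet> b) (u \<bullet> b))" for z
  proof -
    have "complex_of_real (\<Prod>i\<in>UNIV. std_normal_density (z $ i)) * iexp (u \<bullet> z) =
        (\<Prod>i\<in>UNIV. ?g (z $ i) (u $ i))"
      by (simp add: inner_vec_def prod.distrib exp_sum[symmetric] sum_distrib_left)
    also have "\<dots> = (\<Prod>b\<in>Basis. ?g (z \<bullet> b) (u \<bullet> b))"
      by (rule prod_UNIV_vec_eq_prod_Basis)
    finally show ?thesis .
  qed
  have int: "integrable lborel (\<lambda>a. ?g a t)" for t
    by (rule Bochner_Integration.integrable_bound[OF integrable_normal_moment[of 1 0 0]])
       (auto simp: norm_mult)
  have ch: "(CLINT a|lborel. ?g a t) = complex_of_real (exp (- t\<^sup>2 / 2))" for t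
  proof -
    have "(CLINT a|lborel. ?g a t) = char std_normal_distribution t"
      by (simp add: char_def integral_density scaleR_conv_of_real)
    then show ?thesis
      by (simp add: char_std_normal_distribution)
  qed
  have "(CLINT z|std_normal_vec. iexp (u \<bullet> z)) =
      (CLINT z|lborel. complex_of_real (\<Prod>i\<in>UNIV. std_normal_density (z $ i)) * iexp (u \<bullet> z))"
    unfolding std_normal_vec_def
    by (subst integral_density) (auto simp: scaleR_conv_of_real intro!: prod_nonneg)
  also have "\<dots> = (CLINT z|lborel. (\<Prod>b\<in>Basis. ?g (z \<bullet> b) (u \<bullet> b)))"
    by (simp only: 1)
  \<comment> \<open>\<open>lborel\<close> is the image of a product of real Lebesgue measures under
    the map that assembles a vector from its coordinates, so the integral of a product
    splits.\<close>
  also have "\<dots> = (CLINT f|(\<Pi>\<^sub>M b\<in>(Basis :: (real ^ 'p) set). lborel). (\<Prod>b\<in>Basis. ?g (f b) (u \<bullet> b)))"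
    by (subst lborel_eq, subst integral_distr)
       (auto intro!: Bochner_Integration.integral_cong prod.cong simp: inner_sum_left inner_Basis
         if_distrib sum.delta cong: if_cong)
  also have "\<dots> = (\<Prod>b\<in>Basis. CLINT a|lborel. ?g a (u \<bullet> b))"
    by (rule P.product_integral_prod[OF finite_Basis int])
  also have "\<dots> = (\<Prod>b\<in>Basis. complex_of_real (exp (- (u \<bullet> b)\<^sup>2 / 2)))"
    by (simp only: ch)
  also have "\<dots> = complex_of_real (exp (\<Sum>b\<in>Basis. - (u \<bullet> b)\<^sup>2 / 2))"
    by (simp add: exp_sum)
  also have "(\<Sum>b\<in>Basis. - (u \<bullet> b)\<^sup>2 / 2) = - (norm u)\<^sup>2 / 2"
  proof -
    have "(norm u)\<^sup>2 = (\<Sum>b\<in>Basis. (u \<bullet> b)\<^sup>2)"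
      unfolding power2_norm_eq_inner by (subst euclidean_inner) (simp add: power2_eq_square)
    then show ?thesis by (simp add: sum_divide_distrib[symmetric] sum_negf)
  qed
  finally show ?thesis .
qed

lemma measurable_matrix_vector_mult [measurable]:
  "(\<lambda>z. A *v z) \<in> borel_measurable (borel :: (real ^ 'n) measure)"
  by (intro borel_measurable_continuous_onI linear_continuous_on matrix_vector_mul_bounded_linear)

text \<open>Moving A across the inner product turns u into \<open>transpose A *v u\<close>, whose
  squared norm is the quadratic form of \<open>A ** transpose A\<close>. So A enters only through
  this product.\<close>

lemma char_normal_vec:
  fixes u :: "real ^ 'p"
  assumes "pos_semidef V"
  shows "(CLINT z|normal_vec 0 V. iexp (u \<bullet> z)) = complex_of_real (exp (- (u \<bullet> (V *v u)) / 2))"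
proof -
  define A where "A = (SOME A :: real ^ 'p ^ 'p. A ** transpose A = V)"
  have A: "A ** transpose A = V"
    unfolding A_def using someI_ex[OF pos_semidef_square_root[OF assms]] .
  have "u \<bullet> (A *v z) = (transpose A *v u) \<bullet> z" for z
    by (simp only: transpose_matrix_vector dot_lmul_matrix)
  then have "(CLINT z|normal_vec 0 V. iexp (u \<bullet> z)) =
      (CLINT z|std_normal_vec. iexp ((transpose A *v u) \<bullet> z))"
    by (simp add: normal_vec_def A_def[symmetric] integral_distr)
  also have "\<dots> = complex_of_real (exp (- (norm (transpose A *v u))\<^sup>2 / 2))"
    by (rule char_std_normal_vec)
  also have "(norm (transpose A *v u))\<^sup>2 = u \<bullet> (V *v u)"
    by (metis (no_types) A dot_lmul_matrix matrix_vector_mul_assoc power2_norm_eq_inner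
        transpose_matrix_vector)
  finally show ?thesis .
qed

lemma prob_space_normal_vec: "prob_space (normal_vec \<mu> V)"
  unfolding normal_vec_def
  by (rule prob_space.prob_space_distr[OF prob_space_std_normal_vec]) measurable

lemma sets_normal_vec [measurable_cong, simp]: "sets (normal_vec \<mu> V) = sets borel"
  by (simp add: normal_vec_def)

section \<open>Levy continuity in several dimensions\<close>

text \<open>A Gaussian is its own Fourier transform up to scaling, and Fubini's theorem moves the
  transform onto \<mu>. A functional that detects mass far out thus becomes an average of the
  characteristic function, to which dominated convergence applies.\<close>

lemma gaussian_integral_eq_integral_char:
  fixes \<mu> :: "(real ^ 'p) measure"
  assumes "prob_space \<mu>" and [measurable_cong]: "sets \<mu> = sets borel"
  shows "complex_of_real (LINT x|\<mu>. exp (- (norm (s *\<^sub>R x))\<^sup>2 / 2)) =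
    (CLINT z|std_normal_vec. CLINT x|\<mu>. iexp ((s *\<^sub>R z) \<bullet> x))"
proof -
  interpret \<mu>: prob_space \<mu> by fact
  interpret G: prob_space "std_normal_vec :: (real ^ 'p) measure"
    by (rule prob_space_std_normal_vec)
  interpret P: pair_prob_space \<mu> "std_normal_vec :: (real ^ 'p) measure" ..
  have "complex_of_real (LINT x|\<mu>. exp (- (norm (s *\<^sub>R x))\<^sup>2 / 2)) =
      (CLINT x|\<mu>. CLINT z|std_normal_vec. iexp ((s *\<^sub>R x) \<bullet> z))"
    by (simp add: char_std_normal_vec del: inner_scaleR_left inner_scaleR_right norm_scaleR)
  also have "\<dots> = (CLINT x|\<mu>. CLINT z|std_normal_vec. iexp ((s *\<^sub>R z) \<bullet> x))"
    by (simp add: inner_commute)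
  also have "\<dots> = (CLINT z|std_normal_vec. CLINT x|\<mu>. iexp ((s *\<^sub>R z) \<bullet> x))"
    by (rule P.Fubini_integral[symmetric], rule P.integrable_const_bound[where B=1])
       (auto simp: case_prod_beta)
  finally show ?thesis .
qed

section \<open>Trigonometric polynomials as test functions\<close>

text \<open>The phase \<theta> supplies the sines and the constants. The set is an algebra, as
  Stone--Weierstrass requires, and the integrals of its members are determined by the characteristic
  function.\<close>

inductive_set trig_polys :: "('a::real_inner \<Rightarrow> real) set" where
  cos: "(\<lambda>x. a * cos (u \<bullet> x + \<theta>)) \<in> trig_polys"
| add: "f \<in> trig_polys \<Longrightarrow> g \<in> trig_polys \<Longrightarrow> (\<lambda>x. f x + g x) \<in> trig_polys"

lemma trig_polys_const: "(\<lambda>_. c) \<in> trig_polys"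
  using trig_polys.cos[of c 0 0] by simp

lemma trig_polys_mult:
  assumes "f \<in> trig_polys" "g \<in> trig_polys"
  shows "(\<lambda>x. f x * g x) \<in> trig_polys"
  using assms(1)
proof induction
  case (cos a u \<theta>)
  show ?case
    using assms(2)
  proof induction
    case (cos b v \<tau>)
    have "(\<lambda>x. a * cos (u \<bullet> x + \<theta>) * (b * cos (v \<bullet> x + \<tau>))) =
        (\<lambda>x. a * b / 2 * cos ((u - v) \<bullet> x + (\<theta> - \<tau>)) + a * b / 2 * cos ((u + v) \<bullet> x + (\<theta> + \<tau>)))"
    proof
      fix x
      have *: "cos (u \<bullet> x + \<theta>) * cos (v \<bullet> x + \<tau>) =
        (cos ((u - v) \<bullet> x + (\<theta> - \<tau>)) + cos ((u + v) \<bullet> x + (\<theta> + \<tau>))) / 2"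
        unfolding cos_times_cos by (simp add: inner_diff_left inner_add_left algebra_simps)
      have "a * cos (u \<bullet> x + \<theta>) * (b * cos (v \<bullet> x + \<tau>)) =
        a * b * (cos (u \<bullet> x + \<theta>) * cos (v \<bullet> x + \<tau>))"
        by simp
      also have "\<dots> = a * b / 2 * cos ((u - v) \<bullet> x + (\<theta> - \<tau>)) + a * b / 2 * cos ((u + v) \<bullet> x + (\<theta> + \<tau>))"
        unfolding * by (simp only: add_divide_distrib distrib_left times_divide_eq_right times_divide_eq_left)
      finally show "a * cos (u \<bullet> x + \<theta>) * (b * cos (v \<bullet> x + \<tau>)) =
        a * b / 2 * cos ((u - v) \<bullet> x + (\<theta> - \<tau>)) + a * b / 2 * cos ((u + v) \<bullet> x + (\<theta> + \<tau>))" .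
    qed
    then show ?case
      by (simp only: trig_polys.intros)
  next
    case (add f g)
    then show ?case
      by (simp add: distrib_left trig_polys.add)
  qed
next
  case (add f g)
  then show ?case
    by (simp add: distrib_right trig_polys.add)
qed

lemma trig_polys_continuous: "f \<in> trig_polys \<Longrightarrow> continuous_on S f"
  by (induction rule: trig_polys.induct) (auto intro!: continuous_intros)

lemma trig_polys_bounded: "f \<in> trig_polys \<Longrightarrow> \<exists>C. \<forall>x. \<bar>f x\<bar> \<le> C"
proof (induction rule: trig_polys.induct)
  case (cos a u \<theta>)
  have "\<bar>a * cos (u \<bullet> x + \<theta>)\<bar> \<le> \<bar>a\<bar>" for x
    by (simp add: abs_mult mult_left_le)
  then show ?case by blast
next
  case (add f g)
  then obtain C D where "\<forall>x. \<bar>f x\<bar> \<le> C" "\<forall>x. \<bar>g x\<bar> \<le> D" by blast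
  then have "\<forall>x. \<bar>f x + g x\<bar> \<le> C + D"
    by (metis abs_triangle_ineq add_mono order_trans)
  then show ?case by blast
qed

lemma trig_polys_separate:
  assumes "x \<noteq> y"
  shows "\<exists>f\<in>trig_polys. f x \<noteq> f y"
proof -
  \<comment> \<open>The scaling puts x and y half a period apart: with phase
    \<open>- u \<bullet> y\<close> the cosine is -1 at x and 1 at y.\<close>
  define u where "u = (pi / (norm (x - y))\<^sup>2) *\<^sub>R (x - y)"
  have "u \<bullet> (x - y) = pi"
    using assms by (simp add: u_def power2_norm_eq_inner)
  then have "u \<bullet> x + - u \<bullet> y = pi" by (simp add: inner_diff_right)
  then have "1 * cos (u \<bullet> x + (- u \<bullet> y)) \<noteq> 1 * cos (u \<bullet> y + (- u \<bullet> y))"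
    by simp
  with trig_polys.cos[of 1 u "- u \<bullet> y"] show ?thesis
    by (intro bexI[of _ "\<lambda>x. 1 * cos (u \<bullet> x + (- u \<bullet> y))"]) auto
qed

lemma trig_polys_compose_polynomial:
  fixes p :: "real \<Rightarrow> real"
  assumes "real_polynomial_function p" "f \<in> trig_polys"
  shows "(\<lambda>x. p (f x)) \<in> trig_polys"
  using assms
proof (induction rule: real_polynomial_function.induct)
  case (linear h)
  have "h t = h 1 * t" for t
    using linear_scale[OF bounded_linear.linear[OF linear(1)], of t 1] by simp
  then have "(\<lambda>x. h (f x)) = (\<lambda>x. h 1 * f x)" by blast
  with trig_polys_mult[OF trig_polys_const[of "h 1"] linear(2)] show ?case by simp
qed (auto intro: trig_polys_const trig_polys.add trig_polys_mult)

text \<open>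
  Stone--Weierstrass controls the approximant on the ball only. Composing it with a polynomial
  close to the truncation at level \<open>K\<close> makes the bound global.
\<close>

lemma trig_polys_approx_bounded:
  fixes f :: "'a::euclidean_space \<Rightarrow> real"
  assumes f: "continuous_on UNIV f" and K: "\<And>x. \<bar>f x\<bar> \<le> K" and e: "0 < e"
  obtains P where "P \<in> trig_polys" "\<And>x. \<bar>P x\<bar> \<le> K + e" "\<And>x. norm x \<le> R \<Longrightarrow> \<bar>f x - P x\<bar> \<le> e"
proof -
  interpret function_ring_on "trig_polys :: ('a \<Rightarrow> real) set" "cball 0 R"
    by standard
       (auto intro: trig_polys_continuous trig_polys.add trig_polys_mult trig_polys_const
         trig_polys_separate)
  obtain Q where Q: "Q \<in> trig_polys" and fQ: "\<forall>x\<in>cball 0 R. \<bar>f x - Q x\<bar> < e / 2"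
    using Stone_Weierstrass_basic[of f "e / 2"] continuous_on_subset[OF f] e by auto
  obtain C where C: "\<forall>x. \<bar>Q x\<bar> \<le> C"
    using trig_polys_bounded[OF Q] by blast
  define c where "c t = max (- K) (min K t)" for t
  have "continuous_on {- C..C} c"
    unfolding c_def by (intro continuous_intros)
  then obtain p where p: "real_polynomial_function p" and cp: "\<And>t. t \<in> {- C..C} \<Longrightarrow> \<bar>c t - p t\<bar> < e / 2"
    using Stone_Weierstrass_real_polynomial_function[of "{- C..C}" c "e / 2"] e by auto
  have cp: "\<bar>c (Q x) - p (Q x)\<bar> < e / 2" for x
    using C[rule_format, of x] by (intro cp) auto
  show ?thesis
  proof
    show "(\<lambda>x. p (Q x)) \<in> trig_polys"
      by (rule trig_polys_compose_polynomial[OF p Q])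
    show "\<bar>p (Q x)\<bar> \<le> K + e" for x
      using cp[of x] K[of x] e unfolding c_def by linarith
    \<comment> \<open>Since \<open>f x\<close> lies in [-K, K], truncating \<open>Q x\<close> to
      this interval does not increase its distance from \<open>f x\<close>. The two errors of e / 2
      add up.\<close>
    show "\<bar>f x - p (Q x)\<bar> \<le> e" if "norm x \<le> R" for x
    proof -
      have "\<bar>f x - Q x\<bar> < e / 2" using fQ that by simp
      then show ?thesis
        using cp[of x] K[of x] unfolding c_def by linarith
    qed
  qed
qed

text \<open>
  Tightness comes from the Gaussian averages of the characteristic functions: the integral of
  \<open>1 - exp (- s\<^sup>2 \<parallel>x\<parallel>\<^sup>2 / 2)\<close> bounds the mass outside a ball and converges to its value under the limit.
\<close>

lemma levy_continuity_vec:
  fixes \<mu> :: "nat \<Rightarrow> (real ^ 'p) measure" and f :: "real ^ 'p \<Rightarrow> real"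
  assumes \<mu>: "\<And>n. prob_space (\<mu> n)" and sets_\<mu>: "\<And>n. sets (\<mu> n) = sets borel"
    and N: "prob_space N" and sets_N: "sets N = sets borel"
    and char: "\<And>u. (\<lambda>n. CLINT x|\<mu> n. iexp (u \<bullet> x)) \<longlonglongrightarrow> (CLINT x|N. iexp (u \<bullet> x))"
    and f: "continuous_on UNIV f" "bounded (range f)"
  shows "(\<lambda>n. LINT x|\<mu> n. f x) \<longlonglongrightarrow> (LINT x|N. f x)"
proof -
  note [measurable_cong] = sets_\<mu> sets_N
  have [measurable]: "f \<in> borel_measurable borel"
    by (rule borel_measurable_continuous_onI[OF f(1)])
  obtain K where K: "\<And>x. \<bar>f x\<bar> \<le> K"
    using f(2) by (auto simp: bounded_iff)
  have K0: "0 \<le> K" using K[of 0] by simp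
  have ib: "integrable \<nu> h" if "prob_space \<nu>" "h \<in> borel_measurable \<nu>" "\<And>x. norm (h x) \<le> B"
    for \<nu> :: "(real ^ 'p) measure" and h :: "_ \<Rightarrow> 'b::{banach,second_countable_topology}" and B
  proof -
    interpret prob_space \<nu> by fact
    show ?thesis by (rule integrable_const_bound[where B=B]) (use that in auto)
  qed
  have trig: "(\<lambda>n. LINT x|\<mu> n. P x) \<longlonglongrightarrow> (LINT x|N. P x)" if "P \<in> trig_polys" for P
    using that
  proof induction
    case (cos a u \<theta>)
    have eq: "(LINT x|\<nu>. a * cos (u \<bullet> x + \<theta>)) = a * Re (iexp \<theta> * (CLINT x|\<nu>. iexp (u \<bullet> x)))"
      if "prob_space \<nu>" and [measurable_cong]: "sets \<nu> = sets borel" for \<nu> :: "(real ^ 'p) measure"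
    proof -
      have int: "integrable \<nu> (\<lambda>x. iexp (u \<bullet> x))"
        by (rule ib[OF that(1), of _ 1]) auto
      have "Re (iexp \<theta> * (CLINT x|\<nu>. iexp (u \<bullet> x))) = Re (CLINT x|\<nu>. iexp \<theta> * iexp (u \<bullet> x))"
        by simp
      also have "\<dots> = (LINT x|\<nu>. Re (iexp \<theta> * iexp (u \<bullet> x)))"
        by (rule integral_Re[symmetric]) (use int in auto)
      also have "\<dots> = (LINT x|\<nu>. cos (u \<bullet> x + \<theta>))"
        by (simp add: cos_add Re_exp Im_exp mult.commute)
      finally show ?thesis by simp
    qed
    show ?case
      unfolding eq[OF \<mu> sets_\<mu>] eq[OF N sets_N] by (intro tendsto_intros char)
  next
    case (add g h)
    obtain C D where CD: "\<And>x. \<bar>g x\<bar> \<le> C" "\<And>x. \<bar>h x\<bar> \<le> D"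
      using add.hyps trig_polys_bounded by metis
    have [measurable]: "g \<in> borel_measurable borel" "h \<in> borel_measurable borel"
      using add.hyps by (auto intro!: borel_measurable_continuous_onI trig_polys_continuous)
    have eq: "(LINT x|\<nu>. g x + h x) = (LINT x|\<nu>. g x) + (LINT x|\<nu>. h x)"
      if "prob_space \<nu>" and [measurable_cong]: "sets \<nu> = sets borel" for \<nu> :: "(real ^ 'p) measure"
      by (intro Bochner_Integration.integral_add ib[OF that(1), of _ C] ib[OF that(1), of _ D])
         (auto simp: CD)
    show ?case
      unfolding eq[OF \<mu> sets_\<mu>] eq[OF N sets_N] by (intro tendsto_add add.IH)
  qed
  define H where "H s x = exp (- (norm (s *\<^sub>R x))\<^sup>2 / 2)" for s :: real and x :: "real ^ 'p"
  have H_bounds: "0 \<le> H s x" "H s x \<le> 1" for s x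
    by (simp_all add: H_def)
  have [measurable]: "H s \<in> borel_measurable borel" for s
    unfolding H_def by measurable
  have H_conv: "(\<lambda>n. LINT x|\<mu> n. H s x) \<longlonglongrightarrow> (LINT x|N. H s x)" for s
  proof -
    interpret G: prob_space "std_normal_vec :: (real ^ 'p) measure"
      by (rule prob_space_std_normal_vec)
    have meas: "(\<lambda>z. CLINT x|\<nu>. iexp ((s *\<^sub>R z) \<bullet> x)) \<in> borel_measurable std_normal_vec"
      if "prob_space \<nu>" and [measurable_cong]: "sets \<nu> = sets borel" for \<nu> :: "(real ^ 'p) measure"
    proof -
      interpret prob_space \<nu> by fact
      show ?thesis by measurable
    qed
    have "(\<lambda>n. CLINT z|std_normal_vec. CLINT x|\<mu> n. iexp ((s *\<^sub>R z) \<bullet> x)) \<longlonglongrightarrow>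
        (CLINT z|std_normal_vec. CLINT x|N. iexp ((s *\<^sub>R z) \<bullet> x))"
    proof (rule integral_dominated_convergence[where w="\<lambda>_. 1"])
      show "AE z in std_normal_vec. norm (CLINT x|\<mu> n. iexp ((s *\<^sub>R z) \<bullet> x)) \<le> 1" for n
      proof (rule AE_I2)
        fix z :: "real ^ 'p"
        interpret prob_space "\<mu> n" by (rule \<mu>)
        have "norm (CLINT x|\<mu> n. iexp ((s *\<^sub>R z) \<bullet> x)) \<le> (LINT x|\<mu> n. norm (iexp ((s *\<^sub>R z) \<bullet> x)))"
          by (rule integral_norm_bound)
        also have "\<dots> = 1" by (simp add: prob_space)
        finally show "norm (CLINT x|\<mu> n. iexp ((s *\<^sub>R z) \<bullet> x)) \<le> 1" .
      qed
      show "AE z in std_normal_vec. (\<lambda>n. CLINT x|\<mu> n. iexp ((s *\<^sub>R z) \<bullet> x)) \<longlonglongrightarrow>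
          (CLINT x|N. iexp ((s *\<^sub>R z) \<bullet> x))"
        by (intro AE_I2 char)
    qed (use meas[OF \<mu> sets_\<mu>] meas[OF N sets_N] in auto)
    then have "(\<lambda>n. complex_of_real (LINT x|\<mu> n. H s x)) \<longlonglongrightarrow> complex_of_real (LINT x|N. H s x)"
      unfolding H_def gaussian_integral_eq_integral_char[OF \<mu> sets_\<mu>]
        gaussian_integral_eq_integral_char[OF N sets_N] .
    then show ?thesis
      by (simp only: tendsto_of_real_iff)
  qed
  \<comment> \<open>Passing from f to P costs \<open>e + 2 * (2 * K + 1) * e\<close> under
    \<open>\<mu> n\<close> and once more under N, and the integrals of P differ by at most e;
    together this is the stated multiple of e.\<close>
  have bound: "eventually (\<lambda>n. \<bar>(LINT x|\<mu> n. f x) - (LINT x|N. f x)\<bar> \<le> e * (3 + 4 * (2 * K + 1))) sequentially"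
    if e: "0 < e" "e < 1" for e
  proof -
    interpret N: prob_space N by (rule N)
    \<comment> \<open>As s tends to 0, \<open>H s\<close> tends to 1, so some s makes the integral
      of \<open>1 - H s\<close> under N smaller than e. By \<open>H_conv\<close> the same s serves
      for \<open>\<mu> n\<close> with n large.\<close>
    have "(\<lambda>k. LINT x|N. H (1 / real (Suc k)) x) \<longlonglongrightarrow> (LINT x|N. 1)"
    proof (rule integral_dominated_convergence[where w="\<lambda>_. 1"])
      have "(\<lambda>k. H (1 / real (Suc k)) x) \<longlonglongrightarrow> exp (- (norm (0 *\<^sub>R x))\<^sup>2 / 2)" for x
        unfolding H_def by (intro tendsto_intros LIMSEQ_Suc lim_1_over_n) simp
      then show "AE x in N. (\<lambda>k. H (1 / real (Suc k)) x) \<longlonglongrightarrow> 1" by simp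
    qed (use H_bounds in auto)
    then have "eventually (\<lambda>k. 1 - e < (LINT x|N. H (1 / real (Suc k)) x)) sequentially"
      by (rule order_tendstoD) (use e N.prob_space in auto)
    then obtain k where k: "1 - e < (LINT x|N. H (1 / real (Suc k)) x)"
      by (auto simp: eventually_sequentially)
    define s where "s = 1 / real (Suc k)"
    have s: "0 < s" and Ns: "1 - e < (LINT x|N. H s x)" using k by (simp_all add: s_def)
    \<comment> \<open>Beyond this radius \<open>s * norm x\<close> exceeds 2, so
      \<open>2 * (1 - H s x)\<close> majorises the indicator of the complement of the ball.\<close>
    define R where "R = 2 / s"
    have tail: "1 / 2 \<le> 1 - H s x" if "R < norm x" for x
    proof -
      have "2 < s * norm x" using that s by (simp add: R_def field_simps)
      then have "2\<^sup>2 < (s * norm x)\<^sup>2" by (intro power_strict_mono) auto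
      then have "H s x \<le> exp (- 1)"
        using s by (simp add: H_def)
      also have "exp (- 1 :: real) \<le> 1 / 2"
        using exp_ge_add_one_self[of 1] by (simp add: exp_minus field_simps)
      finally show ?thesis by simp
    qed
    obtain P where P: "P \<in> trig_polys" and Pb: "\<And>x. \<bar>P x\<bar> \<le> K + e"
        and fP: "\<And>x. norm x \<le> R \<Longrightarrow> \<bar>f x - P x\<bar> \<le> e"
      using trig_polys_approx_bounded[OF f(1) K e(1)] by metis
    have [measurable]: "P \<in> borel_measurable borel"
      by (intro borel_measurable_continuous_onI trig_polys_continuous P)
    \<comment> \<open>One inequality for both regions: on the ball the error is e, and outside it
      the crude bound \<open>2 * K + 1\<close> is absorbed by \<open>1 - H s x\<close>, whose
      integrals converge.\<close>
    have pw: "\<bar>f x - P x\<bar> \<le> e + 2 * (2 * K + 1) * (1 - H s x)" for x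
    proof (cases "norm x \<le> R")
      case True
      then have "\<bar>f x - P x\<bar> \<le> e" by (rule fP)
      also have "\<dots> \<le> e + 2 * (2 * K + 1) * (1 - H s x)"
        using K0 H_bounds[of s x] by simp
      finally show ?thesis .
    next
      case False
      have "\<bar>f x - P x\<bar> \<le> 2 * K + 1"
        using K[of x] Pb[of x] e by linarith
      also have "\<dots> = 2 * (2 * K + 1) * (1 / 2)"
        by simp
      also have "\<dots> \<le> 2 * (2 * K + 1) * (1 - H s x)"
        using K0 tail[of x] False by (intro mult_left_mono) auto
      finally show ?thesis using e by simp
    qed
    have diff: "\<bar>(LINT x|\<nu>. f x) - (LINT x|\<nu>. P x)\<bar> \<le> e + 2 * (2 * K + 1) * (1 - (LINT x|\<nu>. H s x))"
      if "prob_space \<nu>" and [measurable_cong]: "sets \<nu> = sets borel" for \<nu> :: "(real ^ 'p) measure"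
    proof -
      interpret prob_space \<nu> by fact
      have ints [simp]: "integrable \<nu> f" "integrable \<nu> P" "integrable \<nu> (H s)"
        using K Pb H_bounds by (auto intro!: ib[OF that(1)])
      have "\<bar>(LINT x|\<nu>. f x) - (LINT x|\<nu>. P x)\<bar> = \<bar>LINT x|\<nu>. f x - P x\<bar>"
        by simp
      also have "\<dots> \<le> (LINT x|\<nu>. \<bar>f x - P x\<bar>)"
        by (rule integral_abs_bound)
      also have "\<dots> \<le> (LINT x|\<nu>. e + 2 * (2 * K + 1) * (1 - H s x))"
        by (intro integral_mono pw) auto
      also have "\<dots> = e + 2 * (2 * K + 1) * (1 - (LINT x|\<nu>. H s x))"
        by (simp add: prob_space)
      finally show ?thesis .
    qed
    have "eventually (\<lambda>n. 1 - e < (LINT x|\<mu> n. H s x)) sequentially"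
      using H_conv Ns by (rule order_tendstoD)
    moreover have "eventually (\<lambda>n. dist (LINT x|\<mu> n. P x) (LINT x|N. P x) < e) sequentially"
      using trig[OF P] e(1) by (rule tendstoD)
    ultimately show ?thesis
    proof eventually_elim
      case (elim n)
      have "2 * (2 * K + 1) * (1 - (LINT x|\<nu>. H s x)) \<le> 2 * (2 * K + 1) * e"
        if "1 - e < (LINT x|\<nu>. H s x)" for \<nu>
        using K0 that by (intro mult_left_mono) auto
      from this[OF Ns] this[OF elim(1)] show ?case
        using diff[OF \<mu>[of n] sets_\<mu>] diff[OF N sets_N] elim(2)
        by (simp add: dist_real_def algebra_simps)
    qed
  qed
  show ?thesis
  proof (rule tendstoI)
    fix \<epsilon> :: real assume \<epsilon>: "0 < \<epsilon>"
    define L where "L = 3 + 4 * (2 * K + 1)"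
    have L: "0 < L" using K0 by (simp add: L_def)
    define e where "e = min (1 / 2) (\<epsilon> / (2 * L))"
    have e: "0 < e" "e < 1" using \<epsilon> L by (auto simp: e_def)
    have "e * L \<le> \<epsilon> / (2 * L) * L" using L by (intro mult_right_mono) (auto simp: e_def)
    also have "\<dots> < \<epsilon>" using L \<epsilon> by simp
    finally have "e * L < \<epsilon>" .
    with bound[OF e] show "eventually (\<lambda>n. dist (LINT x|\<mu> n. f x) (LINT x|N. f x) < \<epsilon>) sequentially"
      unfolding L_def[symmetric] by (auto simp: dist_real_def elim!: eventually_mono)
  qed
qed

section \<open>Expansion of the characteristic function of an importance weight\<close>

text \<open>The left side is the integrand in the remainder of \<open>char_approx3'\<close>. Divided
  by \<open>x\<^sup>2\<close> it is min(6, y) with y = |t x|, and min(6, y) is at most 6 y^\<delta>: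
  for y at most 1 because y is at most y^\<delta>, which uses \<delta> \<le> 1, and otherwise
  because y^\<delta> is at least 1.\<close>

lemma min_square_cube_le_powr:
  fixes t x \<delta> :: real
  assumes "0 < \<delta>" "\<delta> \<le> 1"
  shows "min (6 * x\<^sup>2) (\<bar>t\<bar> * \<bar>x\<bar> ^ 3) \<le> 6 * \<bar>t\<bar> powr \<delta> * \<bar>x\<bar> powr (2 + \<delta>)"
proof (cases "t = 0 \<or> x = 0")
  case False
  then have x: "0 < \<bar>x\<bar>" and t: "0 < \<bar>t\<bar>" by auto
  have eq: "\<bar>t\<bar> powr \<delta> * \<bar>x\<bar> powr (2 + \<delta>) = x\<^sup>2 * \<bar>t * x\<bar> powr \<delta>"
    using x by (simp add: powr_add abs_mult powr_mult)
  show ?thesis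
  proof (cases "\<bar>t * x\<bar> \<le> 1")
    case True
    have "\<bar>t * x\<bar> powr 1 \<le> \<bar>t * x\<bar> powr \<delta>"
      using True assms by (intro powr_mono') auto
    then have "x\<^sup>2 * \<bar>t * x\<bar> \<le> x\<^sup>2 * \<bar>t * x\<bar> powr \<delta>"
      using x t by (intro mult_left_mono) auto
    moreover have "\<bar>t\<bar> * \<bar>x\<bar> ^ 3 = x\<^sup>2 * \<bar>t * x\<bar>"
      by (simp add: abs_mult power2_eq_square power3_eq_cube flip: power2_abs)
    moreover have "0 \<le> x\<^sup>2 * \<bar>t * x\<bar> powr \<delta>" by simp
    ultimately have "\<bar>t\<bar> * \<bar>x\<bar> ^ 3 \<le> 6 * (x\<^sup>2 * \<bar>t * x\<bar> powr \<delta>)"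
      by linarith
    then show ?thesis
      unfolding mult.assoc eq by (rule min.coboundedI2)
  next
    case False
    then have "1 \<le> \<bar>t * x\<bar> powr \<delta>"
      using assms by (intro ge_one_powr_ge_zero) auto
    then have "6 * x\<^sup>2 * 1 \<le> 6 * x\<^sup>2 * \<bar>t * x\<bar> powr \<delta>"
      by (intro mult_left_mono) auto
    then show ?thesis
      unfolding mult.assoc eq by (intro min.coboundedI1) simp
  qed
qed auto

text \<open>On a probability space this does the work of Jensen's inequality: lower moments are
  controlled by the top one at the price of an additive 1, the source of the summands 1 in later
  constants.\<close>

lemma powr_le_1_plus_powr:
  fixes y a b :: real
  assumes "0 \<le> y" "0 \<le> a" "a \<le> b"
  shows "y powr a \<le> 1 + y powr b"
proof (cases "1 \<le> y")
  case True
  then have "y powr a \<le> y powr b" using assms by (intro powr_mono) auto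
  then show ?thesis by simp
next
  case False
  then have "y powr a \<le> 1" using assms by (intro powr_le1) auto
  then show ?thesis by (smt (verit) powr_ge_zero)
qed

text \<open>The cubic Taylor remainder is interpolated with the quadratic one, since no third moment
  is assumed. The 1 / 6 of the remainder cancels the 6 of the interpolation.\<close>

lemma (in prob_space) char_approx_powr:
  fixes X :: "'a \<Rightarrow> real"
  assumes [measurable]: "X \<in> borel_measurable M"
    and \<delta>: "0 < \<delta>" "\<delta> \<le> 1"
    and int: "integrable M (\<lambda>\<omega>. \<bar>X \<omega>\<bar> powr (2 + \<delta>))"
    and mean: "expectation X = 0"
  shows "cmod ((CLINT \<omega>|M. iexp (t * X \<omega>)) - (1 - t\<^sup>2 * expectation (\<lambda>\<omega>. (X \<omega>)\<^sup>2) / 2)) \<le>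
    \<bar>t\<bar> powr (2 + \<delta>) * expectation (\<lambda>\<omega>. \<bar>X \<omega>\<bar> powr (2 + \<delta>))"
proof -
  have le: "\<bar>y\<bar> \<le> 1 + \<bar>y\<bar> powr (2 + \<delta>)" "y\<^sup>2 \<le> 1 + \<bar>y\<bar> powr (2 + \<delta>)" for y :: real
    using powr_le_1_plus_powr[of "\<bar>y\<bar>" 1 "2 + \<delta>"] powr_le_1_plus_powr[of "\<bar>y\<bar>" 2 "2 + \<delta>"] \<delta> by auto
  have int1: "integrable M (\<lambda>\<omega>. 1 + \<bar>X \<omega>\<bar> powr (2 + \<delta>))"
    using int by simp
  have X1: "integrable M X"
    by (rule Bochner_Integration.integrable_bound[OF int1]) (use le(1) in auto)
  have X2: "integrable M (\<lambda>\<omega>. (X \<omega>)\<^sup>2)"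
    by (rule Bochner_Integration.integrable_bound[OF int1]) (use le(2) in auto)
  have "cmod (char (distr M borel X) t - (1 - t\<^sup>2 * expectation (\<lambda>\<omega>. (X \<omega>)\<^sup>2) / 2)) \<le>
      (t\<^sup>2 / 6) * expectation (\<lambda>\<omega>. min (6 * (X \<omega>)\<^sup>2) (\<bar>t\<bar> * \<bar>X \<omega>\<bar> ^ 3))"
    by (rule char_approx3') (use X1 X2 mean in auto)
  also have "\<dots> \<le> (t\<^sup>2 / 6) * expectation (\<lambda>\<omega>. 6 * \<bar>t\<bar> powr \<delta> * \<bar>X \<omega>\<bar> powr (2 + \<delta>))"
  proof (intro mult_left_mono integral_mono)
    show "integrable M (\<lambda>\<omega>. min (6 * (X \<omega>)\<^sup>2) (\<bar>t\<bar> * \<bar>X \<omega>\<bar> ^ 3))"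
      by (rule Bochner_Integration.integrable_bound[OF integrable_mult_right[OF X2, of 6]]) auto
  qed (use int min_square_cube_le_powr[OF \<delta>] in auto)
  also have "\<dots> = \<bar>t\<bar> powr (2 + \<delta>) * expectation (\<lambda>\<omega>. \<bar>X \<omega>\<bar> powr (2 + \<delta>))"
    by (cases "t = 0") (auto simp: powr_add)
  finally show ?thesis
    by (simp add: char_def integral_distr)
qed

section \<open>The importance weight under a sampling policy\<close>

lemma powr_sum_le:
  fixes a b p :: real
  assumes "0 \<le> a" "0 \<le> b" "0 \<le> p"
  shows "(a + b) powr p \<le> 2 powr p * (a powr p + b powr p)"
proof -
  have "(a + b) powr p \<le> (2 * max a b) powr p"
    using assms by (intro powr_mono2) auto
  also have "\<dots> = 2 powr p * max a b powr p"
    using assms by (simp add: powr_mult)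
  also have "max a b powr p \<le> a powr p + b powr p"
    by (auto simp: max_def)
  finally show ?thesis by simp
qed

lemma prob_space_density_prob_density:
  "prob_density q \<Longrightarrow> prob_space (density lborel (\<lambda>y. ennreal (q y)))"
  by (intro prob_spaceI) (auto simp: prob_density_def emeasure_density)

text \<open>Where q vanishes and \<phi> does not, the \<open>ennreal\<close> quotient is infinite,
  which a finite integral allows on a null set only. This reconciles the real convention a / 0 = 0
  with the extended one.\<close>

lemma ais_moment_finite_imp_density_pos:
  fixes \<phi> :: "real ^ 'd \<Rightarrow> real ^ 'p"
  assumes q: "prob_density q" and [measurable]: "\<phi> \<in> borel_measurable borel"
    and fin: "ais_moment \<eta> q \<phi> \<noteq> \<infinity>"
  shows "AE y in lborel. \<phi> y \<noteq> 0 \<longrightarrow> 0 < q y"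
proof -
  have [measurable]: "q \<in> borel_measurable borel" and q0: "\<And>y. 0 \<le> q y"
    using q by (auto simp: prob_density_def)
  have "AE y in lborel. ennreal (norm (\<phi> y) powr (2 + \<eta>)) / ennreal (q y powr (1 + \<eta>)) \<noteq> \<infinity>"
    using fin unfolding ais_moment_def by (intro nn_integral_PInf_AE) auto
  then show ?thesis
  proof eventually_elim
    case (elim y)
    show ?case
    proof (rule ccontr)
      assume "\<not> (\<phi> y \<noteq> 0 \<longrightarrow> 0 < q y)"
      then have "\<phi> y \<noteq> 0" "q y = 0" using q0[of y] by auto
      with elim show False
        by (simp add: ennreal_divide_top ennreal_divide_zero)
    qed
  qed
qed

text \<open>Where q > 0, q (|\<phi>| / q)^(2 + \<eta>) = |\<phi>|^(2 + \<eta>) / q^(1 + \<eta>);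
  elsewhere \<phi> is almost everywhere 0. The moment condition is thus a moment of order 2 + \<eta>
  of the weight under its own sampling law.\<close>

lemma nn_integral_weighted_powr_eq_ais_moment:
  fixes \<phi> :: "real ^ 'd \<Rightarrow> real ^ 'p"
  assumes q: "prob_density q" and [measurable]: "\<phi> \<in> borel_measurable borel"
    and fin: "ais_moment \<eta> q \<phi> \<noteq> \<infinity>"
  shows "(\<integral>\<^sup>+y. ennreal (norm ((1 / q y) *\<^sub>R \<phi> y) powr (2 + \<eta>)) \<partial>density lborel (\<lambda>y. ennreal (q y))) =
    ais_moment \<eta> q \<phi>"
proof -
  have [measurable]: "q \<in> borel_measurable borel" and q0: "\<And>y. 0 \<le> q y"
    using q by (auto simp: prob_density_def)
  have "(\<integral>\<^sup>+y. ennreal (norm ((1 / q y) *\<^sub>R \<phi> y) powr (2 + \<eta>)) \<partial>density lborel (\<lambda>y. ennreal (q y))) =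
      (\<integral>\<^sup>+y. ennreal (q y) * ennreal (norm ((1 / q y) *\<^sub>R \<phi> y) powr (2 + \<eta>)) \<partial>lborel)"
    by (rule nn_integral_density) auto
  also have "\<dots> = ais_moment \<eta> q \<phi>"
    unfolding ais_moment_def
  proof (rule nn_integral_cong_AE)
    show "AE y in lborel. ennreal (q y) * ennreal (norm ((1 / q y) *\<^sub>R \<phi> y) powr (2 + \<eta>)) =
        ennreal (norm (\<phi> y) powr (2 + \<eta>)) / ennreal (q y powr (1 + \<eta>))"
      using ais_moment_finite_imp_density_pos[OF assms]
    proof eventually_elim
      case (elim y)
      show ?case
      proof (cases "q y = 0")
        case True
        then show ?thesis using elim by simp
      next
        case False
        then have qy: "0 < q y" using q0[of y] by simp
        have "q y * norm ((1 / q y) *\<^sub>R \<phi> y) powr (2 + \<eta>) =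
            norm (\<phi> y) powr (2 + \<eta>) * (q y / q y powr (2 + \<eta>))"
          using qy by (simp add: powr_mult powr_divide)
        also have "q y / q y powr (2 + \<eta>) = 1 / q y powr (1 + \<eta>)"
        proof -
          have "q y powr (2 + \<eta>) = q y * q y powr (1 + \<eta>)"
            using qy powr_add[of "q y" 1 "1 + \<eta>"] by (simp add: add.assoc[symmetric])
          then show ?thesis using qy by simp
        qed
        finally show ?thesis
          using qy by (simp add: divide_ennreal ennreal_mult'[symmetric])
      qed
    qed
  qed
  finally show ?thesis .
qed

lemma ais_variance_nth:
  "ais_variance q \<phi> $ i $ k = (LINT y|lborel.
    (\<phi> y $ i - q y * (LINT z|lborel. \<phi> z) $ i) * (\<phi> y $ k - q y * (LINT z|lborel. \<phi> z) $ k) / q y)"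
  by (simp add: ais_variance_def Let_def)

text \<open>\<open>char_approx_powr\<close> is applied to the centred weight under the law with
  density q. In C, \<open>2 powr (2 + \<delta>)\<close> comes from separating the weight from I,
  \<open>norm w\<close> from the Cauchy--Schwarz inequality, and the last factor absorbs the
  centring. Both bounds depend on q only through K; the second one later dominates the conditional
  variances.\<close>

lemma importance_weight_expansion:
  fixes \<phi> :: "real ^ 'd \<Rightarrow> real ^ 'p" and w :: "real ^ 'p"
  assumes q: "prob_density q" and \<phi>: "integrable lborel \<phi>" and \<eta>: "0 < \<eta>"
    and moment: "ais_moment \<eta> q \<phi> \<le> ennreal K" and K: "0 \<le> K"
  defines "I \<equiv> LINT y|lborel. \<phi> y"
    and "\<delta> \<equiv> min 1 \<eta>"
  defines "C \<equiv> (2 * norm w) powr (2 + \<delta>) * (1 + norm I powr (2 + \<delta>))"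
  shows "cmod ((CLINT y|density lborel (\<lambda>y. ennreal (q y)). iexp (t * (w \<bullet> ((1 / q y) *\<^sub>R \<phi> y - I)))) -
      (1 - t\<^sup>2 * (w \<bullet> (ais_variance q \<phi> *v w)) / 2)) \<le> \<bar>t\<bar> powr (2 + \<delta>) * (C * (1 + K))"
    and "\<bar>w \<bullet> (ais_variance q \<phi> *v w)\<bar> \<le> 1 + C * (1 + K)"
proof -
  define Q where "Q = density lborel (\<lambda>y. ennreal (q y))"
  interpret Q: prob_space Q
    unfolding Q_def by (rule prob_space_density_prob_density[OF q])
  have [measurable]: "q \<in> borel_measurable borel" and q0: "\<And>y. 0 \<le> q y"
    using q by (auto simp: prob_density_def)
  have [measurable]: "\<phi> \<in> borel_measurable borel"
    using \<phi> by (auto dest: borel_measurable_integrable)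
  have [measurable]: "(\<lambda>y. \<phi> y $ i) \<in> borel_measurable borel" for i
    unfolding cart_eq_inner_axis by measurable
  have [measurable_cong]: "sets Q = sets borel" by (simp add: Q_def)
  have \<delta>: "0 < \<delta>" "\<delta> \<le> 1" "\<delta> \<le> \<eta>" using \<eta> by (auto simp: \<delta>_def)
  have fin: "ais_moment \<eta> q \<phi> \<noteq> \<infinity>"
    using moment by (auto simp: top_unique)
  define \<psi> where "\<psi> y = (1 / q y) *\<^sub>R \<phi> y" for y
  have [measurable]: "\<psi> \<in> borel_measurable borel" unfolding \<psi>_def by measurable
  have pos: "AE y in lborel. \<phi> y \<noteq> 0 \<longrightarrow> 0 < q y"
    by (rule ais_moment_finite_imp_density_pos[OF q _ fin]) simp
  have q\<psi>: "AE y in lborel. q y *\<^sub>R \<psi> y = \<phi> y"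
    using pos by eventually_elim (auto simp: \<psi>_def)
  have nn: "(\<integral>\<^sup>+y. ennreal (norm (\<psi> y) powr (2 + \<eta>)) \<partial>Q) = ais_moment \<eta> q \<phi>"
    unfolding Q_def \<psi>_def by (rule nn_integral_weighted_powr_eq_ais_moment[OF q _ fin]) simp
  have int\<eta>: "integrable Q (\<lambda>y. norm (\<psi> y) powr (2 + \<eta>))"
    using fin nn by (intro integrableI_nonneg) (auto simp: less_top)
  have K_bound: "Q.expectation (\<lambda>y. norm (\<psi> y) powr (2 + \<eta>)) \<le> K"
  proof -
    have "ennreal (Q.expectation (\<lambda>y. norm (\<psi> y) powr (2 + \<eta>))) \<le> ennreal K"
      using moment nn by (subst nn_integral_eq_integral[symmetric, OF int\<eta>]) auto
    then show ?thesis using K by (simp add: ennreal_le_iff)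
  qed
  \<comment> \<open>v is left free: \<open>v = w\<close> bounds Y, and a unit vector bounds
    \<open>norm (\<psi> y - I)\<close> itself, which makes the entries of the covariance matrix
    integrable.\<close>
  have shifted: "(norm v * norm (\<psi> y - I)) powr (2 + \<delta>) \<le>
      (2 * norm v) powr (2 + \<delta>) * (1 + norm I powr (2 + \<delta>)) * (1 + norm (\<psi> y) powr (2 + \<eta>))"
    for v :: "real ^ 'p" and y
  proof -
    have "norm (\<psi> y - I) powr (2 + \<delta>) \<le> (norm (\<psi> y) + norm I) powr (2 + \<delta>)"
      using \<delta> by (intro powr_mono2 norm_triangle_ineq4) auto
    also have "\<dots> \<le> 2 powr (2 + \<delta>) * (norm (\<psi> y) powr (2 + \<delta>) + norm I powr (2 + \<delta>))"
      using \<delta> by (intro powr_sum_le) auto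
    also have "\<dots> \<le> 2 powr (2 + \<delta>) * ((1 + norm (\<psi> y) powr (2 + \<eta>)) + norm I powr (2 + \<delta>))"
      using \<delta> by (intro mult_left_mono add_right_mono powr_le_1_plus_powr) auto
    also have "\<dots> \<le> 2 powr (2 + \<delta>) * ((1 + norm I powr (2 + \<delta>)) * (1 + norm (\<psi> y) powr (2 + \<eta>)))"
      by (intro mult_left_mono) (auto simp: algebra_simps)
    finally have "norm v powr (2 + \<delta>) * norm (\<psi> y - I) powr (2 + \<delta>) \<le> norm v powr (2 + \<delta>) *
        (2 powr (2 + \<delta>) * ((1 + norm I powr (2 + \<delta>)) * (1 + norm (\<psi> y) powr (2 + \<eta>))))"
      by (intro mult_left_mono) auto
    then show ?thesis by (simp add: powr_mult mult_ac)
  qed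
  define Y where "Y y = w \<bullet> (\<psi> y - I)" for y
  have [measurable]: "Y \<in> borel_measurable borel" unfolding Y_def by measurable
  have Y_le: "\<bar>Y y\<bar> powr (2 + \<delta>) \<le> C * (1 + norm (\<psi> y) powr (2 + \<eta>))" for y
  proof -
    have "\<bar>Y y\<bar> powr (2 + \<delta>) \<le> (norm w * norm (\<psi> y - I)) powr (2 + \<delta>)"
      unfolding Y_def using \<delta> by (intro powr_mono2 Cauchy_Schwarz_ineq2) auto
    also note shifted
    finally show ?thesis unfolding C_def .
  qed
  have C0: "0 \<le> C" unfolding C_def by (intro mult_nonneg_nonneg add_nonneg_nonneg) auto
  have intY: "integrable Q (\<lambda>y. \<bar>Y y\<bar> powr (2 + \<delta>))"
  proof (rule Bochner_Integration.integrable_bound)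
    show "integrable Q (\<lambda>y. C * (1 + norm (\<psi> y) powr (2 + \<eta>)))" using int\<eta> by simp
  qed (use Y_le in \<open>auto intro: order_trans[OF _ abs_ge_self]\<close>)
  have EY: "Q.expectation (\<lambda>y. \<bar>Y y\<bar> powr (2 + \<delta>)) \<le> C * (1 + K)"
  proof -
    have "Q.expectation (\<lambda>y. \<bar>Y y\<bar> powr (2 + \<delta>)) \<le>
        Q.expectation (\<lambda>y. C * (1 + norm (\<psi> y) powr (2 + \<eta>)))"
      using intY int\<eta> by (intro integral_mono Y_le) auto
    also have "\<dots> = C * (1 + Q.expectation (\<lambda>y. norm (\<psi> y) powr (2 + \<eta>)))"
      using int\<eta> by (simp add: Q.prob_space)
    also have "\<dots> \<le> C * (1 + K)"
      using C0 K_bound by (intro mult_left_mono) auto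
    finally show ?thesis .
  qed
  have int2: "integrable Q (\<lambda>y. (norm (\<psi> y - I))\<^sup>2)"
  proof (rule Bochner_Integration.integrable_bound)
    show "integrable Q (\<lambda>y. 1 + 2 powr (2 + \<delta>) * (1 + norm I powr (2 + \<delta>)) * (1 + norm (\<psi> y) powr (2 + \<eta>)))"
      using int\<eta> by (intro Bochner_Integration.integrable_add integrable_mult_right) auto
    have "(norm (\<psi> y - I))\<^sup>2 \<le> 1 + 2 powr (2 + \<delta>) * (1 + norm I powr (2 + \<delta>)) * (1 + norm (\<psi> y) powr (2 + \<eta>))" for y
    proof -
      have "norm (\<psi> y - I) powr 2 \<le> 1 + norm (\<psi> y - I) powr (2 + \<delta>)"
        using \<delta> by (intro powr_le_1_plus_powr) auto
      then show ?thesis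
        using shifted[of "axis undefined 1" y] by (simp add: norm_axis_1)
    qed
    then show "AE y in Q. norm ((norm (\<psi> y - I))\<^sup>2) \<le>
        norm (1 + 2 powr (2 + \<delta>) * (1 + norm I powr (2 + \<delta>)) * (1 + norm (\<psi> y) powr (2 + \<eta>)))"
      by (auto intro: order_trans[OF _ abs_ge_self])
  qed simp
  have meanY: "Q.expectation Y = 0"
  proof -
    \<comment> \<open>Unbiasedness of the weight: by \<open>q\<psi>\<close> no mass of \<phi> is
      lost where q vanishes.\<close>
    have "integrable lborel (\<lambda>y. q y *\<^sub>R \<psi> y) \<longleftrightarrow> integrable lborel \<phi>"
      by (rule integrable_cong_AE) (use q\<psi> in auto)
    then have "integrable Q \<psi>"
      unfolding Q_def using \<phi> q0 by (subst integrable_density) auto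
    moreover have "Q.expectation \<psi> = (LINT y|lborel. q y *\<^sub>R \<psi> y)"
      unfolding Q_def by (rule integral_density) (auto simp: q0)
    moreover have "(LINT y|lborel. q y *\<^sub>R \<psi> y) = I"
      unfolding I_def by (rule integral_cong_AE) (use q\<psi> in auto)
    ultimately have "integrable Q (\<lambda>y. \<psi> y - I)" "Q.expectation (\<lambda>y. \<psi> y - I) = 0"
      by (simp_all add: Q.prob_space)
    then show ?thesis
      unfolding Y_def by (subst integral_inner_right) auto
  qed
  have varY: "Q.expectation (\<lambda>y. (Y y)\<^sup>2) = w \<bullet> (ais_variance q \<phi> *v w)"
  proof -
    define e where "e i k y = (\<psi> y - I) $ i * (\<psi> y - I) $ k" for i k y
    have [measurable]: "e i k \<in> borel_measurable borel" for i k unfolding e_def cart_eq_inner_axis by measurable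
    have e_int: "integrable Q (e i k)" for i k
    proof (rule Bochner_Integration.integrable_bound[OF int2])
      have "\<bar>e i k y\<bar> \<le> norm (\<psi> y - I) * norm (\<psi> y - I)" for y
        unfolding e_def abs_mult by (intro mult_mono component_le_norm_cart) auto
      then show "AE y in Q. norm (e i k y) \<le> norm ((norm (\<psi> y - I))\<^sup>2)"
        by (auto simp: power2_eq_square)
    qed simp
    have e_eq: "Q.expectation (e i k) = ais_variance q \<phi> $ i $ k" for i k
    proof -
      have "Q.expectation (e i k) = (LINT y|lborel. q y *\<^sub>R e i k y)"
        unfolding Q_def by (rule integral_density) (auto simp: q0)
      also have "\<dots> = (LINT y|lborel. (\<phi> y $ i - q y * I $ i) * (\<phi> y $ k - q y * I $ k) / q y)"
      proof (rule integral_cong_AE)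
        show "AE y in lborel. q y *\<^sub>R e i k y = (\<phi> y $ i - q y * I $ i) * (\<phi> y $ k - q y * I $ k) / q y"
          using pos
        proof eventually_elim
          case (elim y)
          \<comment> \<open>Where \<open>q y = 0\<close> both sides are 0, the right one by the
            convention a / 0 = 0.\<close>
          show ?case
          proof (cases "q y = 0")
            case False
            then have "(\<phi> y $ j - q y * I $ j) = q y * (\<psi> y - I) $ j" for j
              by (simp add: \<psi>_def field_simps)
            then show ?thesis using False by (simp add: e_def)
          qed simp
        qed
      qed auto
      also have "\<dots> = ais_variance q \<phi> $ i $ k"
        by (simp add: ais_variance_nth I_def)
      finally show ?thesis .
    qed
    have "(Y y)\<^sup>2 = (\<Sum>i\<in>UNIV. \<Sum>k\<in>UNIV. w $ i * w $ k * e i k y)" for y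
      by (simp add: Y_def e_def inner_vec_def power2_eq_square sum_product mult_ac)
    then have "Q.expectation (\<lambda>y. (Y y)\<^sup>2) = (\<Sum>i\<in>UNIV. \<Sum>k\<in>UNIV. w $ i * w $ k * ais_variance q \<phi> $ i $ k)"
      using e_int by (simp add: e_eq)
    also have "\<dots> = w \<bullet> (ais_variance q \<phi> *v w)"
      by (simp add: inner_vec_def matrix_vector_mult_def sum_distrib_left mult_ac)
    finally show ?thesis .
  qed
  have "cmod ((CLINT y|Q. iexp (t * Y y)) - (1 - t\<^sup>2 * Q.expectation (\<lambda>y. (Y y)\<^sup>2) / 2)) \<le>
      \<bar>t\<bar> powr (2 + \<delta>) * Q.expectation (\<lambda>y. \<bar>Y y\<bar> powr (2 + \<delta>))"
    by (rule Q.char_approx_powr) (use \<delta> intY meanY in auto)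
  also have "\<dots> \<le> \<bar>t\<bar> powr (2 + \<delta>) * (C * (1 + K))"
    by (intro mult_left_mono EY) auto
  finally show "cmod ((CLINT y|density lborel (\<lambda>y. ennreal (q y)). iexp (t * (w \<bullet> ((1 / q y) *\<^sub>R \<phi> y - I)))) -
      (1 - t\<^sup>2 * (w \<bullet> (ais_variance q \<phi> *v w)) / 2)) \<le> \<bar>t\<bar> powr (2 + \<delta>) * (C * (1 + K))"
    unfolding varY unfolding Q_def Y_def \<psi>_def .
  have "0 \<le> Q.expectation (\<lambda>y. (Y y)\<^sup>2)" by simp
  moreover have "Q.expectation (\<lambda>y. (Y y)\<^sup>2) \<le> Q.expectation (\<lambda>y. 1 + \<bar>Y y\<bar> powr (2 + \<delta>))"
  proof (rule integral_mono)
    show le: "(Y y)\<^sup>2 \<le> 1 + \<bar>Y y\<bar> powr (2 + \<delta>)" for y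
      using powr_le_1_plus_powr[of "\<bar>Y y\<bar>" 2 "2 + \<delta>"] \<delta> by simp
    show "integrable Q (\<lambda>y. 1 + \<bar>Y y\<bar> powr (2 + \<delta>))" using intY by simp
    then show "integrable Q (\<lambda>y. (Y y)\<^sup>2)"
      by (rule Bochner_Integration.integrable_bound) (use le in auto)
  qed
  moreover have "\<dots> \<le> 1 + C * (1 + K)"
    using EY intY by (simp add: Q.prob_space)
  ultimately show "\<bar>w \<bullet> (ais_variance q \<phi> *v w)\<bar> \<le> 1 + C * (1 + K)"
    unfolding varY by simp
qed

section \<open>Exponential remainder and Cesaro means\<close>

lemma exp_minus_quadratic_bound:
  fixes b :: real
  assumes "0 \<le> b"
  shows "\<bar>1 - b - exp (- b)\<bar> \<le> b\<^sup>2 / 2"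
proof -
  have "1 - b \<le> exp (- b)" using exp_ge_add_one_self[of "- b"] by simp
  moreover have "exp (- b) \<le> 1 - b + b\<^sup>2 / 2"
  proof -
    \<comment> \<open>The quadratic Taylor polynomials of exp at b and at -b multiply to 1 + b^4 /
      4. As the former is at most \<open>exp b\<close>, the latter is at least
      \<open>exp (- b)\<close>.\<close>
    have "1 \<le> 1 + b ^ 4 / 4" by simp
    also have "\<dots> = (1 - b + b\<^sup>2 / 2) * (1 + b + b\<^sup>2 / 2)"
      by (simp add: field_simps power2_eq_square power4_eq_xxxx)
    also have "\<dots> \<le> (1 - b + b\<^sup>2 / 2) * exp b"
    proof (rule mult_left_mono)
      show "1 + b + b\<^sup>2 / 2 \<le> exp b" by (rule exp_lower_Taylor_quadratic[OF assms])
      have "0 \<le> ((1 - b)\<^sup>2 + 1) / 2" by simp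
      also have "\<dots> = 1 - b + b\<^sup>2 / 2" by (simp add: power2_eq_square field_simps)
      finally show "0 \<le> 1 - b + b\<^sup>2 / 2" .
    qed
    finally show ?thesis by (simp add: exp_minus field_simps)
  qed
  ultimately show ?thesis by (simp add: abs_le_iff)
qed

lemma cesaro_mean_tendsto:
  fixes a :: "nat \<Rightarrow> real"
  assumes "a \<longlonglongrightarrow> l"
  shows "(\<lambda>n. (\<Sum>k<n. a k) / real n) \<longlonglongrightarrow> l"
proof (rule tendstoI)
  fix e :: real assume e: "0 < e"
  obtain N where N: "\<And>k. N \<le> k \<Longrightarrow> \<bar>a k - l\<bar> < e / 2"
    using LIMSEQ_D[OF assms, of "e / 2"] e by auto
  define C where "C = (\<Sum>k<N. \<bar>a k - l\<bar>)"
  have "(\<lambda>n. C / real n) \<longlonglongrightarrow> 0"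
    by (rule lim_const_over_n)
  then have "eventually (\<lambda>n. C / real n < e / 2) sequentially"
    by (rule order_tendstoD) (use e in simp)
  moreover have "eventually (\<lambda>n. 0 < n \<and> N \<le> n) sequentially"
    by (intro eventually_conj eventually_gt_at_top eventually_ge_at_top)
  ultimately show "eventually (\<lambda>n. dist ((\<Sum>k<n. a k) / real n) l < e) sequentially"
  proof eventually_elim
    case (elim n)
    then have n: "0 < n" "N \<le> n" by auto
    have "\<bar>\<Sum>k<n. a k - l\<bar> \<le> (\<Sum>k<n. \<bar>a k - l\<bar>)" by (rule sum_abs)
    also have "\<dots> = C + (\<Sum>k=N..<n. \<bar>a k - l\<bar>)"
    proof -
      have "{..<n} = {..<N} \<union> {N..<n}" "{..<N} \<inter> {N..<n} = {}" using n by auto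
      then show ?thesis unfolding C_def by (simp add: sum.union_disjoint)
    qed
    also have "(\<Sum>k=N..<n. \<bar>a k - l\<bar>) \<le> (\<Sum>k=N..<n. e / 2)"
      by (intro sum_mono order.strict_implies_order[OF N]) auto
    also have "\<dots> \<le> real n * (e / 2)"
      using e by (auto intro!: mult_right_mono)
    finally have "\<bar>\<Sum>k<n. a k - l\<bar> / real n \<le> C / real n + e / 2"
      using n by (simp add: field_simps)
    also have "\<dots> < e" using elim(1) by linarith
    also have "\<bar>\<Sum>k<n. a k - l\<bar> / real n = \<bar>(\<Sum>k<n. a k) / real n - l\<bar>"
    proof -
      have "(\<Sum>k<n. a k) / real n - l = (\<Sum>k<n. a k - l) / real n"
        using n by (simp add: sum_subtractf diff_divide_distrib)
      then show ?thesis by simp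
    qed
    finally show ?case by (simp add: dist_real_def)
  qed
qed

section \<open>Conditioning on the past samples\<close>

lemma space_sample_algebra [simp]: "space (sample_algebra M x n) = space M"
  by (simp add: sample_algebra_def space_measure_of_conv)

lemma sets_sample_algebra:
  "sets (sample_algebra M x n) =
    sigma_sets (space M) {x j -` A \<inter> space M | j A. j \<in> {1..n} \<and> A \<in> sets borel}"
  unfolding sample_algebra_def by (rule sets_measure_of) auto

context adaptive_importance_sampling
begin

lemma subalgebra_sample_algebra: "subalgebra M (sample_algebra M x n)"
  unfolding subalgebra_def sets_sample_algebra space_sample_algebra
  by (auto intro!: sets.sigma_sets_subset measurable_sets sample_measurable)

lemma sample_measurable_sample_algebra:
  assumes "1 \<le> j" "j \<le> n"
  shows "x j \<in> borel_measurable (sample_algebra M x n)"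
proof (rule measurableI)
  show "x j -` A \<inter> space (sample_algebra M x n) \<in> sets (sample_algebra M x n)"
    if "A \<in> sets borel" for A
    unfolding sets_sample_algebra space_sample_algebra
    by (rule sigma_sets.Basic) (use assms that in auto)
qed simp

lemma subalgebra_sample_algebra_mono:
  assumes "m \<le> n"
  shows "subalgebra (sample_algebra M x n) (sample_algebra M x m)"
  unfolding subalgebra_def sets_sample_algebra space_sample_algebra
proof (intro conjI refl sigma_sets_mono', clarify)
  fix j A assume "j \<in> {1..m}" "A \<in> sets (borel :: (real ^ 'd) measure)"
  then show "\<exists>j' A'. x j -` A \<inter> space M = x j' -` A' \<inter> space M \<and> j' \<in> {1..n} \<and> A' \<in> sets borel"
    using assms by (intro exI[of _ j] exI[of _ A]) auto
qed

text \<open>\<open>sample_cond_density\<close> holds for each A outside a null set that may depend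
  on A. Integrated over an event B of the past it becomes an identity for the rectangle
  \<open>B \<times> A\<close>, and the rectangles form a generator stable under intersection.
  Keeping \<omega> itself as first coordinate, with the past as \<sigma>-algebra, represents all
  earlier samples at once.\<close>

lemma distr_sample_eq_density:
  "distr M (sample_algebra M x k \<Otimes>\<^sub>M borel) (\<lambda>\<omega>. (\<omega>, x (Suc k) \<omega>)) =
    density (restr_to_subalg M (sample_algebra M x k) \<Otimes>\<^sub>M lborel) (\<lambda>(\<omega>, y). ennreal (q k \<omega> y))"
  (is "?D = ?N")
proof -
  let ?F = "sample_algebra M x k"
  let ?E = "{B \<times> A | B A. B \<in> sets ?F \<and> A \<in> sets (borel :: (real ^ 'd) measure)}"
  note sub = subalgebra_sample_algebra[of k]
  interpret S: finite_measure_subalgebra M ?F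
    by standard (rule sub)
  interpret lborel: sigma_finite_measure "lborel :: (real ^ 'd) measure"
    by (rule sigma_finite_lborel)
  note [measurable] = sample_measurable[of "Suc k", simplified] policy_measurable[of k]
  note [measurable_cong] = sets_restr_to_subalg[OF sub]
  have id: "(\<lambda>\<omega>. \<omega>) \<in> M \<rightarrow>\<^sub>M ?F"
    using measurable_from_subalg[OF sub measurable_ident_sets[OF refl]] by simp
  have pair [measurable]: "(\<lambda>\<omega>. (\<omega>, x (Suc k) \<omega>)) \<in> M \<rightarrow>\<^sub>M ?F \<Otimes>\<^sub>M borel"
    using id by measurable
  have sets_prod: "sets (restr_to_subalg M ?F \<Otimes>\<^sub>M lborel) = sets (?F \<Otimes>\<^sub>M (borel :: (real ^ 'd) measure))"
    by (rule sets_pair_measure_cong) (simp_all add: sets_restr_to_subalg[OF sub])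
  have q [measurable]: "(\<lambda>(\<omega>, y). ennreal (q k \<omega> y)) \<in> borel_measurable (restr_to_subalg M ?F \<Otimes>\<^sub>M lborel)"
    using policy_measurable[of k] unfolding measurable_cong_sets[OF sets_prod refl] by measurable
  show ?thesis
  proof (rule measure_eqI_generator_eq[where E="?E" and \<Omega>="space M \<times> UNIV" and A="\<lambda>_. space M \<times> UNIV"])
    show "Int_stable ?E"
      by (rule Int_stable_pair_measure_generator)
    show "?E \<subseteq> Pow (space M \<times> UNIV)"
      using sets.sets_into_space[of _ ?F] by auto
    show "sets ?D = sigma_sets (space M \<times> UNIV) ?E"
      by (simp add: sets_pair_measure)
    show "sets ?N = sigma_sets (space M \<times> UNIV) ?E"
      unfolding sets_density sets_prod by (simp add: sets_pair_measure)
    show "range (\<lambda>_. space M \<times> UNIV) \<subseteq> ?E"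
      using sets.top[of ?F] by (intro image_subsetI CollectI exI[of _ "space M"] exI[of _ UNIV]) auto
    show "emeasure ?D (space M \<times> UNIV) \<noteq> \<infinity>"
    proof -
      interpret D: prob_space ?D by (rule prob_space_distr[OF pair])
      show ?thesis using D.emeasure_finite[of "space M \<times> UNIV"] by simp
    qed
    show "emeasure ?D X = emeasure ?N X" if "X \<in> ?E" for X
    proof -
      from that obtain B A where X: "X = B \<times> A" and B: "B \<in> sets ?F" and A [measurable]: "A \<in> sets borel"
        by blast
      have BM [measurable]: "B \<in> sets M" using B sub by (auto simp: subalgebra_def)
      have BR [measurable]: "B \<in> sets (restr_to_subalg M ?F)" using B by (simp add: sets_restr_to_subalg[OF sub])
      have dens: "(\<integral>\<^sup>+y. ennreal (q k \<omega> y) * indicator A y \<partial>lborel) = ennreal (LINT y:A|lborel. q k \<omega> y)"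
        if "\<omega> \<in> space M" for \<omega>
      proof -
        have pd: "q k \<omega> \<in> borel_measurable borel" "\<And>y. 0 \<le> q k \<omega> y" "(\<integral>\<^sup>+y. ennreal (q k \<omega> y) \<partial>lborel) = 1"
          using policy_density[OF that] by (auto simp: prob_density_def)
        have "integrable lborel (q k \<omega>)"
          using pd(1) by (intro integrableI_nonneg) (simp_all add: pd)
        then have si: "set_integrable lborel A (q k \<omega>)"
          unfolding set_integrable_def by (intro integrable_mult_indicator) auto
        have "(\<integral>\<^sup>+y. ennreal (q k \<omega> y) * indicator A y \<partial>lborel) =
            (\<integral>\<^sup>+y. ennreal (indicator A y *\<^sub>R q k \<omega> y) \<partial>lborel)"
          by (intro nn_integral_cong) (auto simp: indicator_def)
        also have "\<dots> = ennreal (LINT y:A|lborel. q k \<omega> y)"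
          unfolding set_lebesgue_integral_def
          using si[unfolded set_integrable_def] pd(2)
          by (intro nn_integral_eq_integral) (auto simp: indicator_def)
        finally show "(\<integral>\<^sup>+y. ennreal (q k \<omega> y) * indicator A y \<partial>lborel) = ennreal (LINT y:A|lborel. q k \<omega> y)" .
      qed
      have dens0: "0 \<le> (LINT y:A|lborel. q k \<omega> y)" if "\<omega> \<in> space M" for \<omega>
        unfolding set_lebesgue_integral_def
        using policy_density[OF that] by (intro integral_nonneg_AE) (auto simp: prob_density_def indicator_def)
      let ?X = "\<lambda>\<omega>. indicator A (x (Suc k) \<omega>) :: real"
      let ?c = "real_cond_exp M ?F ?X"
      have int: "integrable M ?X"
        by (rule integrable_const_bound[where B=1]) auto
      have ae: "AE \<omega> in M. ?c \<omega> = (LINT y:A|lborel. q k \<omega> y)"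
        using sample_cond_density[of "Suc k" A] by simp
      have "emeasure ?D X = emeasure M ((\<lambda>\<omega>. (\<omega>, x (Suc k) \<omega>)) -` (B \<times> A) \<inter> space M)"
        unfolding X by (rule emeasure_distr[OF pair]) (use B in auto)
      also have "\<dots> = (\<integral>\<^sup>+\<omega>. ennreal (indicator B \<omega> *\<^sub>R ?X \<omega>) \<partial>M)"
      proof -
        have "((\<lambda>\<omega>. (\<omega>, x (Suc k) \<omega>)) -` (B \<times> A) \<inter> space M) = B \<inter> (x (Suc k) -` A \<inter> space M)"
          using sets.sets_into_space[OF BM] by auto
        moreover have "B \<inter> (x (Suc k) -` A \<inter> space M) \<in> sets M" by measurable
        moreover have "(\<integral>\<^sup>+\<omega>. ennreal (indicator B \<omega> *\<^sub>R ?X \<omega>) \<partial>M) =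
            (\<integral>\<^sup>+\<omega>. indicator (B \<inter> (x (Suc k) -` A \<inter> space M)) \<omega> \<partial>M)"
          by (intro nn_integral_cong) (auto simp: indicator_def)
        ultimately show ?thesis by simp
      qed
      also have "\<dots> = ennreal (LINT \<omega>:B|M. ?X \<omega>)"
        unfolding set_lebesgue_integral_def
        using integrable_mult_indicator[OF BM int] by (intro nn_integral_eq_integral) auto
      also have "(LINT \<omega>:B|M. ?X \<omega>) = (LINT \<omega>:B|M. ?c \<omega>)"
        by (rule S.real_cond_exp_intA[OF int B])
      also have "ennreal \<dots> = (\<integral>\<^sup>+\<omega>. ennreal (indicator B \<omega> *\<^sub>R ?c \<omega>) \<partial>M)"
        unfolding set_lebesgue_integral_def
      proof (rule nn_integral_eq_integral[symmetric])
        show "integrable M (\<lambda>\<omega>. indicator B \<omega> *\<^sub>R ?c \<omega>)"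
          by (intro integrable_mult_indicator[OF BM] S.real_cond_exp_int(1)[OF int])
        show "AE \<omega> in M. 0 \<le> indicator B \<omega> *\<^sub>R ?c \<omega>"
          using ae by (rule AE_mp) (auto intro!: AE_I2 simp: dens0)
      qed
      also have "\<dots> = (\<integral>\<^sup>+\<omega>. (\<integral>\<^sup>+y. ennreal (q k \<omega> y) * indicator A y \<partial>lborel) * indicator B \<omega> \<partial>M)"
      proof (rule nn_integral_cong_AE)
        show "AE \<omega> in M. ennreal (indicator B \<omega> *\<^sub>R ?c \<omega>) =
            (\<integral>\<^sup>+y. ennreal (q k \<omega> y) * indicator A y \<partial>lborel) * indicator B \<omega>"
          using ae AE_space
        proof eventually_elim
          case (elim \<omega>)
          show ?case
            unfolding dens[OF elim(2)] elim(1) by (cases "\<omega> \<in> B") simp_all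
        qed
      qed
      \<comment> \<open>The integrand is measurable with respect to the past, so M may be replaced
        by its restriction, the first factor of the product in \<open>?N\<close>.\<close>
      also have "\<dots> = (\<integral>\<^sup>+\<omega>. (\<integral>\<^sup>+y. ennreal (q k \<omega> y) * indicator A y \<partial>lborel) * indicator B \<omega> \<partial>restr_to_subalg M ?F)"
        by (rule nn_integral_subalgebra2[OF sub, symmetric]) (use B in measurable)
      also have "\<dots> = (\<integral>\<^sup>+\<omega>. (\<integral>\<^sup>+y. ennreal (q k \<omega> y) * indicator (B \<times> A) (\<omega>, y) \<partial>lborel) \<partial>restr_to_subalg M ?F)"
        by (intro nn_integral_cong) (auto simp: indicator_def)
      also have "\<dots> = (\<integral>\<^sup>+p. (case p of (\<omega>, y) \<Rightarrow> ennreal (q k \<omega> y)) * indicator (B \<times> A) p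
          \<partial>(restr_to_subalg M ?F \<Otimes>\<^sub>M lborel))"
        by (subst lborel.nn_integral_fst[symmetric]) auto
      also have "\<dots> = emeasure ?N X"
        unfolding X by (rule emeasure_density[symmetric]) (use BR in auto)
      finally show ?thesis .
    qed
  qed auto
qed

text \<open>The tower rule in Fubini form: the inner integral is a version of the conditional
  expectation of \<open>h \<omega> (x (Suc k) \<omega>)\<close> given the past. Conditioning is used
  in this shape from here on, with h a complex exponential.\<close>

lemma integral_sample:
  fixes h :: "'w \<Rightarrow> real ^ 'd \<Rightarrow> 'c :: {banach, second_countable_topology}"
  assumes h [measurable]: "(\<lambda>(\<omega>, y). h \<omega> y) \<in> borel_measurable (sample_algebra M x k \<Otimes>\<^sub>M borel)"
    and bound: "\<And>\<omega> y. norm (h \<omega> y) \<le> B"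
  shows "(\<lambda>\<omega>. LINT y|density lborel (\<lambda>y. ennreal (q k \<omega> y)). h \<omega> y) \<in> borel_measurable (sample_algebra M x k)"
    and "(LINT \<omega>|M. h \<omega> (x (Suc k) \<omega>)) =
      (LINT \<omega>|M. LINT y|density lborel (\<lambda>y. ennreal (q k \<omega> y)). h \<omega> y)"
proof -
  let ?F = "sample_algebra M x k"
  let ?R = "restr_to_subalg M ?F"
  note sub = subalgebra_sample_algebra[of k]
  interpret lborel: sigma_finite_measure "lborel :: (real ^ 'd) measure"
    by (rule sigma_finite_lborel)
  interpret R: prob_space ?R
    by (rule prob_space_restr_to_subalg[OF sub prob_space_axioms])
  interpret P: pair_sigma_finite ?R "lborel :: (real ^ 'd) measure" ..
  note [measurable] = sample_measurable[of "Suc k", simplified] policy_measurable[of k]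
  have sets_prod: "sets (?R \<Otimes>\<^sub>M lborel) = sets (?F \<Otimes>\<^sub>M (borel :: (real ^ 'd) measure))"
    by (rule sets_pair_measure_cong) (simp_all add: sets_restr_to_subalg[OF sub])
  have id: "(\<lambda>\<omega>. \<omega>) \<in> M \<rightarrow>\<^sub>M ?F"
    using measurable_from_subalg[OF sub measurable_ident_sets[OF refl]] by simp
  have pair: "(\<lambda>\<omega>. (\<omega>, x (Suc k) \<omega>)) \<in> M \<rightarrow>\<^sub>M ?F \<Otimes>\<^sub>M borel"
    using id by measurable
  have q_meas: "(\<lambda>(\<omega>, y). q k \<omega> y) \<in> borel_measurable (?R \<Otimes>\<^sub>M lborel)"
    using policy_measurable[of k] unfolding measurable_cong_sets[OF sets_prod refl] .
  have h_meas: "(\<lambda>(\<omega>, y). h \<omega> y) \<in> borel_measurable (?R \<Otimes>\<^sub>M lborel)"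
    using h unfolding measurable_cong_sets[OF sets_prod refl] .
  have q0: "AE p in ?R \<Otimes>\<^sub>M lborel. 0 \<le> (case p of (\<omega>, y) \<Rightarrow> q k \<omega> y)"
    by (rule AE_I2)
       (auto simp: space_pair_measure space_restr_to_subalg intro: policy_density[unfolded prob_density_def, THEN conjunct2, THEN conjunct1, rule_format])
  have eq: "(LINT y|density lborel (\<lambda>y. ennreal (q k \<omega> y)). h \<omega> y) = (LINT y|lborel. q k \<omega> y *\<^sub>R h \<omega> y)"
    if \<omega>: "\<omega> \<in> space M" for \<omega>
  proof (rule integral_density)
    have "\<omega> \<in> space ?F" using \<omega> by simp
    from measurable_Pair2[OF h this] show "h \<omega> \<in> borel_measurable lborel" by simp
  qed (use policy_density[OF \<omega>] in \<open>auto simp: prob_density_def\<close>)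
  have qh: "(\<lambda>(\<omega>, y). q k \<omega> y *\<^sub>R h \<omega> y) \<in> borel_measurable (?F \<Otimes>\<^sub>M lborel)"
    by measurable
  have "(\<lambda>\<omega>. LINT y|lborel. q k \<omega> y *\<^sub>R h \<omega> y) \<in> borel_measurable ?F"
    using lborel.borel_measurable_lebesgue_integral[OF qh] .
  then show meas: "(\<lambda>\<omega>. LINT y|density lborel (\<lambda>y. ennreal (q k \<omega> y)). h \<omega> y) \<in> borel_measurable ?F"
    by (subst measurable_cong[OF eq]) simp_all
  \<comment> \<open>Integrability against the product is inherited from the bounded h under the
    joint law, by transport through the density.\<close>
  have int: "integrable (?R \<Otimes>\<^sub>M lborel) (\<lambda>(\<omega>, y). q k \<omega> y *\<^sub>R h \<omega> y)"
  proof -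
    have "integrable M (\<lambda>\<omega>. h \<omega> (x (Suc k) \<omega>))"
      using measurable_compose[OF pair h] bound by (intro integrable_const_bound[where B=B]) auto
    then have "integrable (distr M (?F \<Otimes>\<^sub>M borel) (\<lambda>\<omega>. (\<omega>, x (Suc k) \<omega>))) (\<lambda>(\<omega>, y). h \<omega> y)"
      by (subst integrable_distr_eq[OF pair h]) simp
    then have "integrable (?R \<Otimes>\<^sub>M lborel) (\<lambda>p. (case p of (\<omega>, y) \<Rightarrow> q k \<omega> y) *\<^sub>R (case p of (\<omega>, y) \<Rightarrow> h \<omega> y))"
      unfolding distr_sample_eq_density
      by (subst integrable_density[OF h_meas q_meas q0, symmetric]) (simp add: case_prod_beta')
    then show ?thesis by (simp add: case_prod_beta')
  qed
  have "(LINT \<omega>|M. h \<omega> (x (Suc k) \<omega>)) =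
      (LINT p|distr M (?F \<Otimes>\<^sub>M borel) (\<lambda>\<omega>. (\<omega>, x (Suc k) \<omega>)). (case p of (\<omega>, y) \<Rightarrow> h \<omega> y))"
    by (subst integral_distr[OF pair h]) simp
  also have "\<dots> = (LINT p|(?R \<Otimes>\<^sub>M lborel). (case p of (\<omega>, y) \<Rightarrow> q k \<omega> y) *\<^sub>R (case p of (\<omega>, y) \<Rightarrow> h \<omega> y))"
    unfolding distr_sample_eq_density
    by (subst integral_density[OF h_meas q_meas q0, symmetric]) (simp add: case_prod_beta')
  also have "\<dots> = (LINT p|(?R \<Otimes>\<^sub>M lborel). (case p of (\<omega>, y) \<Rightarrow> q k \<omega> y *\<^sub>R h \<omega> y))"
    by (simp add: case_prod_beta')
  also have "\<dots> = (LINT \<omega>|?R. LINT y|lborel. q k \<omega> y *\<^sub>R h \<omega> y)"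
    using P.integral_fst'[OF int] by simp
  also have "\<dots> = (LINT \<omega>|?R. LINT y|density lborel (\<lambda>y. ennreal (q k \<omega> y)). h \<omega> y)"
    by (intro Bochner_Integration.integral_cong refl eq[symmetric]) (simp add: space_restr_to_subalg)
  also have "\<dots> = (LINT \<omega>|M. LINT y|density lborel (\<lambda>y. ennreal (q k \<omega> y)). h \<omega> y)"
    by (rule integral_subalgebra2[OF sub meas])
  finally show "(LINT \<omega>|M. h \<omega> (x (Suc k) \<omega>)) =
      (LINT \<omega>|M. LINT y|density lborel (\<lambda>y. ennreal (q k \<omega> y)). h \<omega> y)" .
qed

section \<open>Quantities determined by the past\<close>

lemma measurable_ais_moment:
  assumes [measurable]: "\<phi> \<in> borel_measurable borel"
  shows "(\<lambda>\<omega>. ais_moment \<eta> (q k \<omega>) \<phi>) \<in> borel_measurable (sample_algebra M x k)"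
proof -
  interpret lborel: sigma_finite_measure "lborel :: (real ^ 'd) measure"
    by (rule sigma_finite_lborel)
  note [measurable] = policy_measurable[of k]
  show ?thesis
    unfolding ais_moment_def by measurable
qed

lemma measurable_quadratic_form_ais_variance:
  fixes \<phi> :: "real ^ 'd \<Rightarrow> real ^ 'p"
  assumes [measurable]: "\<phi> \<in> borel_measurable borel"
  shows "(\<lambda>\<omega>. w \<bullet> (ais_variance (q k \<omega>) \<phi> *v w)) \<in> borel_measurable (sample_algebra M x k)"
proof -
  interpret lborel: sigma_finite_measure "lborel :: (real ^ 'd) measure"
    by (rule sigma_finite_lborel)
  note [measurable] = policy_measurable[of k]
  define I where "I = (LINT y|lborel. \<phi> y)"
  have [measurable]: "(\<lambda>y. \<phi> y $ i) \<in> borel_measurable borel" for i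
    unfolding cart_eq_inner_axis by measurable
  have "w \<bullet> (ais_variance (q k \<omega>) \<phi> *v w) = (\<Sum>i\<in>UNIV. w $ i * (\<Sum>j\<in>UNIV.
      (LINT y|lborel. (\<phi> y $ i - q k \<omega> y * I $ i) * (\<phi> y $ j - q k \<omega> y * I $ j) / q k \<omega> y) * w $ j))" for \<omega>
    by (simp add: ais_variance_nth inner_vec_def matrix_vector_mult_def I_def)
  then show ?thesis by simp
qed

text \<open>The inequality is strict because \<open>x (Suc k)\<close> enters the past at time
  \<open>Suc k\<close>.\<close>

lemma measurable_past_sample:
  assumes h: "(\<lambda>(\<omega>, y). h \<omega> y) \<in> borel_measurable (sample_algebra M x k \<Otimes>\<^sub>M borel)" and "k < n"
  shows "(\<lambda>\<omega>. h \<omega> (x (Suc k) \<omega>)) \<in> borel_measurable (sample_algebra M x n)"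
proof -
  have id: "(\<lambda>\<omega>. \<omega>) \<in> sample_algebra M x n \<rightarrow>\<^sub>M sample_algebra M x k"
    using measurable_from_subalg[OF subalgebra_sample_algebra_mono[of k n] measurable_ident_sets[OF refl]] assms(2)
    by simp
  have "x (Suc k) \<in> borel_measurable (sample_algebra M x n)"
    using assms(2) by (intro sample_measurable_sample_algebra) auto
  with id have "(\<lambda>\<omega>. (\<omega>, x (Suc k) \<omega>)) \<in> sample_algebra M x n \<rightarrow>\<^sub>M sample_algebra M x k \<Otimes>\<^sub>M borel"
    by measurable
  from measurable_compose[OF this h] show ?thesis by simp
qed

text \<open>
  Conditional characteristic functions are replaced by the deterministic factor \<open>exp (- a)\<close> one at a
  time, starting from the last. All other factors have modulus at most 1.
\<close>

lemma char_sum_le_sum_conditional: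
  fixes \<zeta> :: "nat \<Rightarrow> 'w \<Rightarrow> real ^ 'd \<Rightarrow> real"
  assumes \<zeta>: "\<And>k. (\<lambda>(\<omega>, y). \<zeta> k \<omega> y) \<in> borel_measurable (sample_algebra M x k \<Otimes>\<^sub>M borel)"
    and a: "0 \<le> a"
  shows "cmod ((CLINT \<omega>|M. iexp (t * (\<Sum>k<n. \<zeta> k \<omega> (x (Suc k) \<omega>)))) - exp (- (real n * a))) \<le>
    (\<Sum>k<n. LINT \<omega>|M. cmod ((CLINT y|density lborel (\<lambda>y. ennreal (q k \<omega> y)). iexp (t * \<zeta> k \<omega> y)) - exp (- a)))"
proof (induction n)
  case 0
  then show ?case by (simp add: prob_space)
next
  case (Suc n)
  let ?F = "sample_algebra M x n"
  define S where "S \<omega> = (\<Sum>k<n. \<zeta> k \<omega> (x (Suc k) \<omega>))" for \<omega>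
  define A where "A \<omega> = (CLINT y|density lborel (\<lambda>y. ennreal (q n \<omega> y)). iexp (t * \<zeta> n \<omega> y))" for \<omega>
  note [measurable] = \<zeta>[of n]
  have S_F [measurable]: "S \<in> borel_measurable ?F"
    unfolding S_def by (intro borel_measurable_sum measurable_past_sample \<zeta>) auto
  note sub = subalgebra_sample_algebra[of n]
  have S_M [measurable]: "S \<in> borel_measurable M"
    by (rule measurable_from_subalg[OF sub S_F])
  have A_F: "A \<in> borel_measurable ?F"
    unfolding A_def by (rule integral_sample(1)[where B=1]) auto
  have A_M [measurable]: "A \<in> borel_measurable M"
    by (rule measurable_from_subalg[OF sub A_F])
  have A_le: "cmod (A \<omega>) \<le> 1" if "\<omega> \<in> space M" for \<omega>
  proof -
    interpret Q: prob_space "density lborel (\<lambda>y. ennreal (q n \<omega> y))"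
      by (rule prob_space_density_prob_density[OF policy_density[OF that]])
    have "cmod (A \<omega>) \<le> (LINT y|density lborel (\<lambda>y. ennreal (q n \<omega> y)). cmod (iexp (t * \<zeta> n \<omega> y)))"
      unfolding A_def by (rule integral_norm_bound)
    also have "\<dots> = 1" using Q.prob_space by simp
    finally show ?thesis .
  qed
  have int_S: "integrable M (\<lambda>\<omega>. iexp (t * S \<omega>))"
    by (rule integrable_const_bound[where B=1]) auto
  have int_SA: "integrable M (\<lambda>\<omega>. iexp (t * S \<omega>) * A \<omega>)"
    using A_le by (intro integrable_const_bound[where B=1]) (auto simp: norm_mult)
  have int_A: "integrable M (\<lambda>\<omega>. cmod (A \<omega> - exp (- a)))"
  proof (rule integrable_const_bound[where B=2])
    have "cmod (A \<omega> - exp (- a)) \<le> 1 + 1" if "\<omega> \<in> space M" for \<omega>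
      using norm_triangle_ineq4[of "A \<omega>" "complex_of_real (exp (- a))"] A_le[OF that] a
      by (smt (verit) exp_le_one_iff norm_of_real abs_exp_cancel)
    then show "AE \<omega> in M. norm (cmod (A \<omega> - exp (- a))) \<le> 2" by (auto intro!: AE_I2)
  qed measurable
  have "(CLINT \<omega>|M. iexp (t * (\<Sum>k<Suc n. \<zeta> k \<omega> (x (Suc k) \<omega>)))) =
      (CLINT \<omega>|M. iexp (t * S \<omega>) * iexp (t * \<zeta> n \<omega> (x (Suc n) \<omega>)))"
    by (simp add: S_def distrib_left exp_add)
  \<comment> \<open>S depends on the first n samples only, so its exponential can be part of h and
    then leave the inner integral.\<close>
  also have "\<dots> = (CLINT \<omega>|M. CLINT y|density lborel (\<lambda>y. ennreal (q n \<omega> y)).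
      iexp (t * S \<omega>) * iexp (t * \<zeta> n \<omega> y))"
    by (rule integral_sample(2)[where B=1]) (auto simp: norm_mult)
  also have "\<dots> = (CLINT \<omega>|M. iexp (t * S \<omega>) * A \<omega>)"
    by (simp add: A_def)
  finally have step: "(CLINT \<omega>|M. iexp (t * (\<Sum>k<Suc n. \<zeta> k \<omega> (x (Suc k) \<omega>)))) =
      (CLINT \<omega>|M. iexp (t * S \<omega>) * A \<omega>)" .
  \<comment> \<open>The first summand is the cost of exchanging the last factor. The second is the
    error for n factors, which \<open>exp (- a)\<close> does not enlarge since
    \<open>0 \<le> a\<close>.\<close>
  have "(CLINT \<omega>|M. iexp (t * S \<omega>) * A \<omega>) - exp (- (real (Suc n) * a)) =
      (CLINT \<omega>|M. iexp (t * S \<omega>) * (A \<omega> - exp (- a))) +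
      exp (- a) * ((CLINT \<omega>|M. iexp (t * S \<omega>)) - exp (- (real n * a)))"
  proof -
    have "(CLINT \<omega>|M. iexp (t * S \<omega>) * (A \<omega> - exp (- a))) =
        (CLINT \<omega>|M. iexp (t * S \<omega>) * A \<omega> - iexp (t * S \<omega>) * exp (- a))"
      by (simp add: right_diff_distrib)
    also have "\<dots> = (CLINT \<omega>|M. iexp (t * S \<omega>) * A \<omega>) - (CLINT \<omega>|M. iexp (t * S \<omega>)) * exp (- a)"
      using int_S int_SA by (subst Bochner_Integration.integral_diff) auto
    finally have eq: "(CLINT \<omega>|M. iexp (t * S \<omega>) * (A \<omega> - exp (- a))) = \<dots>" .
    have "exp (- (real (Suc n) * a)) = exp (- a) * exp (- (real n * a))"
      by (simp add: algebra_simps flip: exp_add)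
    then show ?thesis
      unfolding eq by (simp add: algebra_simps)
  qed
  also have "cmod \<dots> \<le> cmod (CLINT \<omega>|M. iexp (t * S \<omega>) * (A \<omega> - exp (- a))) +
      cmod (exp (- a) * ((CLINT \<omega>|M. iexp (t * S \<omega>)) - exp (- (real n * a))))"
    by (rule norm_triangle_ineq)
  also have "cmod (CLINT \<omega>|M. iexp (t * S \<omega>) * (A \<omega> - exp (- a))) \<le>
      (LINT \<omega>|M. cmod (iexp (t * S \<omega>) * (A \<omega> - exp (- a))))"
    by (rule integral_norm_bound)
  also have "\<dots> = (LINT \<omega>|M. cmod (A \<omega> - exp (- a)))"
    by (simp add: norm_mult)
  also have "cmod (exp (- a) * ((CLINT \<omega>|M. iexp (t * S \<omega>)) - exp (- (real n * a)))) \<le>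
      1 * cmod ((CLINT \<omega>|M. iexp (t * S \<omega>)) - exp (- (real n * a)))"
    unfolding norm_mult using a by (intro mult_right_mono) auto
  also have "1 * cmod ((CLINT \<omega>|M. iexp (t * S \<omega>)) - exp (- (real n * a))) \<le>
      (\<Sum>k<n. LINT \<omega>|M. cmod ((CLINT y|density lborel (\<lambda>y. ennreal (q k \<omega> y)). iexp (t * \<zeta> k \<omega> y)) - exp (- a)))"
    using Suc.IH by (simp add: S_def)
  finally show ?case
    unfolding step by (simp add: A_def)
qed

section \<open>Truncation and the central limit theorem\<close>

definition moments_exceed :: "real \<Rightarrow> (real ^ 'd \<Rightarrow> real ^ 'p) \<Rightarrow> real \<Rightarrow> 'w set" where
  "moments_exceed \<eta> \<phi> K = {\<omega> \<in> space M. \<exists>k. ennreal K < ais_moment \<eta> (q k \<omega>) \<phi>}"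

lemma sets_moments_exceed [measurable]:
  assumes \<phi>: "\<phi> \<in> borel_measurable borel"
  shows "moments_exceed \<eta> \<phi> K \<in> sets M"
proof -
  have [measurable]: "(\<lambda>\<omega>. ais_moment \<eta> (q k \<omega>) \<phi>) \<in> borel_measurable M" for k
    by (rule measurable_from_subalg[OF subalgebra_sample_algebra measurable_ais_moment[OF \<phi>]])
  show ?thesis
    unfolding moments_exceed_def by measurable
qed

text \<open>Continuity from above: the events decrease in K, and an \<omega> in all of them has an
  infinite supremum of moments.\<close>

lemma prob_moments_exceed_tendsto_0:
  assumes \<phi>: "\<phi> \<in> borel_measurable borel"
    and moment: "AE \<omega> in M. (SUP j. ais_moment \<eta> (q j \<omega>) \<phi>) < \<infinity>"
  shows "(\<lambda>K. prob (moments_exceed \<eta> \<phi> (real K))) \<longlonglongrightarrow> 0"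
proof -
  let ?A = "\<lambda>K::nat. moments_exceed \<eta> \<phi> (real K)"
  have "(\<lambda>K. prob (?A K)) \<longlonglongrightarrow> prob (\<Inter>K. ?A K)"
  proof (rule finite_Lim_measure_decseq)
    show "decseq ?A"
      unfolding decseq_def moments_exceed_def
      by (auto, meson ennreal_leI le_less_trans of_nat_mono)
  qed (use sets_moments_exceed[OF \<phi>] in auto)
  moreover have "prob (\<Inter>K. ?A K) = 0"
  proof (rule prob_eq_0[THEN iffD2])
    show "(\<Inter>K. ?A K) \<in> events" using sets_moments_exceed[OF \<phi>] by auto
    show "AE \<omega> in M. \<omega> \<notin> (\<Inter>K. ?A K)"
      using moment
    proof eventually_elim
      case (elim \<omega>)
      then obtain K :: nat where K: "(SUP j. ais_moment \<eta> (q j \<omega>) \<phi>) \<le> of_nat K"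
        by (metis ennreal_Ex_less_of_nat infinity_ennreal_def less_imp_le)
      have "ais_moment \<eta> (q j \<omega>) \<phi> \<le> ennreal (real K)" for j
        using order_trans[OF SUP_upper[of j UNIV "\<lambda>j. ais_moment \<eta> (q j \<omega>) \<phi>"] K]
        by (simp add: ennreal_of_nat_eq_real_of_nat)
      then have "\<omega> \<notin> ?A K" by (auto simp: moments_exceed_def not_less)
      then show ?case by blast
    qed
  qed
  ultimately show ?thesis by simp
qed

text \<open>
  Dropping the draws made once a moment has exceeded \<open>K\<close> makes all bounds uniform, and it alters
  the sum on the event \<open>moments_exceed \<eta> \<phi> K\<close> only. The conditional variances then no longer tend
  to \<open>s\<close> on that event, whence the last term of the bound.
\<close>

lemma char_ais_estimate_limsup:
  fixes \<phi> :: "real ^ 'd \<Rightarrow> real ^ 'p" and w :: "real ^ 'p"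
  assumes \<phi>: "integrable lborel \<phi>" and \<eta>: "0 < \<eta>" and K: "0 \<le> K"
    and s: "0 \<le> s" and conv: "AE \<omega> in M. (\<lambda>n. w \<bullet> (ais_variance (q n \<omega>) \<phi> *v w)) \<longlonglongrightarrow> s"
  obtains R where "R \<longlonglongrightarrow> (2 + s / 2) * prob (moments_exceed \<eta> \<phi> K)"
    and "\<And>n. 0 < n \<Longrightarrow> cmod ((CLINT \<omega>|M. iexp (1 / sqrt (real n) *
        (\<Sum>k<n. w \<bullet> ((1 / q k \<omega> (x (Suc k) \<omega>)) *\<^sub>R \<phi> (x (Suc k) \<omega>) - (LINT y|lborel. \<phi> y))))) -
      exp (- s / 2)) \<le> R n"
proof -
  define I where "I = (LINT y|lborel. \<phi> y)"
  define \<delta> where "\<delta> = min 1 \<eta>"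
  have \<delta>: "0 < \<delta>" using \<eta> by (simp add: \<delta>_def)
  define L where "L = (2 * norm w) powr (2 + \<delta>) * (1 + norm I powr (2 + \<delta>)) * (1 + K)"
  have L0: "0 \<le> L" unfolding L_def using K by (intro mult_nonneg_nonneg add_nonneg_nonneg) auto
  have \<phi>_meas [measurable]: "\<phi> \<in> borel_measurable borel"
    using \<phi> by (auto dest: borel_measurable_integrable)
  let ?F = "sample_algebra M x"
  note sub = subalgebra_sample_algebra
  define bad where "bad = moments_exceed \<eta> \<phi> K"
  have bad [measurable]: "bad \<in> sets M" unfolding bad_def by (rule sets_moments_exceed) simp
  \<comment> \<open>Only policies up to k are tested, so \<open>good k\<close> is settled before the
    draw \<open>x (Suc k)\<close> and the kept summands stay conditionally centred. The event
    \<open>bad\<close>, where \<open>good\<close> fails at some time, may depend on the whole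
    future.\<close>
  define good where "good k \<omega> \<longleftrightarrow> (\<forall>i\<in>{..k}. ais_moment \<eta> (q i \<omega>) \<phi> \<le> ennreal K)" for k \<omega>
  have good_meas [measurable]: "Measurable.pred (?F k) (good k)" for k
  proof -
    have "(\<lambda>\<omega>. ais_moment \<eta> (q i \<omega>) \<phi>) \<in> borel_measurable (?F k)" if "i \<le> k" for i
      by (rule measurable_from_subalg[OF subalgebra_sample_algebra_mono[OF that] measurable_ais_moment]) simp
    then have "\<And>i. i \<in> {..k} \<Longrightarrow> Measurable.pred (?F k) (\<lambda>\<omega>. ais_moment \<eta> (q i \<omega>) \<phi> \<le> ennreal K)"
      by measurable
    then show ?thesis
      unfolding good_def by (intro pred_intros_finite) auto
  qed
  define Y where "Y k \<omega> y = w \<bullet> ((1 / q k \<omega> y) *\<^sub>R \<phi> y - I)" for k \<omega> y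
  define \<zeta> where "\<zeta> k \<omega> y = (if good k \<omega> then Y k \<omega> y else 0)" for k \<omega> y
  have Y_meas [measurable]: "(\<lambda>(\<omega>, y). Y k \<omega> y) \<in> borel_measurable (?F k \<Otimes>\<^sub>M borel)" for k
  proof -
    note [measurable] = policy_measurable[of k]
    show ?thesis unfolding Y_def by measurable
  qed
  have \<zeta>_meas: "(\<lambda>(\<omega>, y). \<zeta> k \<omega> y) \<in> borel_measurable (?F k \<Otimes>\<^sub>M borel)" for k
    unfolding \<zeta>_def by measurable
  define v where "v k \<omega> = (if good k \<omega> then w \<bullet> (ais_variance (q k \<omega>) \<phi> *v w) else 0)" for k \<omega>
  have v_meas [measurable]: "v k \<in> borel_measurable M" for k
  proof -
    have [measurable]: "(\<lambda>\<omega>. w \<bullet> (ais_variance (q k \<omega>) \<phi> *v w)) \<in> borel_measurable (?F k)"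
      by (rule measurable_quadratic_form_ais_variance) simp
    show ?thesis
      unfolding v_def by (rule measurable_from_subalg[OF sub[of k]]) measurable
  qed
  have v_le: "\<bar>v k \<omega>\<bar> \<le> 1 + L" if "\<omega> \<in> space M" for k \<omega>
  proof (cases "good k \<omega>")
    case True
    then have "ais_moment \<eta> (q k \<omega>) \<phi> \<le> ennreal K" by (auto simp: good_def)
    from importance_weight_expansion(2)[OF policy_density[OF that] \<phi> \<eta> this K, of w] show ?thesis
      using True by (simp add: v_def L_def I_def \<delta>_def)
  qed (use L0 in \<open>simp add: v_def\<close>)
  define e where "e k = (LINT \<omega>|M. \<bar>v k \<omega> - s\<bar>)" for k
  have e_int: "integrable M (\<lambda>\<omega>. \<bar>v k \<omega> - s\<bar>)" for k
  proof (rule integrable_const_bound[where B="1 + L + s"])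
    show "AE \<omega> in M. norm \<bar>v k \<omega> - s\<bar> \<le> 1 + L + s"
      using v_le[of _ k] s by (intro AE_I2) (smt (verit) real_norm_def)
  qed simp
  \<comment> \<open>On \<open>bad\<close> all draws are dropped from some k on, so
    \<open>v k \<omega> = 0\<close> is at distance s from s. Off \<open>bad\<close> nothing is
    dropped and the assumed convergence applies.\<close>
  have e_lim: "e \<longlonglongrightarrow> s * prob bad"
  proof -
    have "e \<longlonglongrightarrow> (LINT \<omega>|M. s * indicator bad \<omega>)"
      unfolding e_def
    proof (rule integral_dominated_convergence[where w="\<lambda>_. 1 + L + s"])
      show "AE \<omega> in M. norm \<bar>v k \<omega> - s\<bar> \<le> 1 + L + s" for k
        using v_le[of _ k] s by (intro AE_I2) (smt (verit) real_norm_def)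
      show "AE \<omega> in M. (\<lambda>k. \<bar>v k \<omega> - s\<bar>) \<longlonglongrightarrow> s * indicator bad \<omega>"
        using conv AE_space
      proof eventually_elim
        case (elim \<omega>)
        show ?case
        proof (cases "\<omega> \<in> bad")
          case True
          then obtain j where j: "ennreal K < ais_moment \<eta> (q j \<omega>) \<phi>"
            by (auto simp: bad_def moments_exceed_def)
          have "\<not> good k \<omega>" if "j \<le> k" for k
            using j that by (auto simp: good_def not_le intro!: bexI[of _ j])
          then have "eventually (\<lambda>k. \<bar>v k \<omega> - s\<bar> = s) sequentially"
            using s by (auto simp: v_def eventually_sequentially)
          then show ?thesis
            using True by (simp add: tendsto_eventually)
        next
          case False
          then have "good k \<omega>" for k
            using elim(2) by (auto simp: bad_def moments_exceed_def good_def not_less)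
          then have "(\<lambda>k. \<bar>v k \<omega> - s\<bar>) \<longlonglongrightarrow> \<bar>s - s\<bar>"
            unfolding v_def using elim(1) by (intro tendsto_intros) simp
          then show ?thesis using False by simp
        qed
      qed
    qed auto
    then show ?thesis by simp
  qed
  \<comment> \<open>Three errors: the Taylor remainder, which is 0 for a dropped draw; the
    replacement of \<open>v k \<omega>\<close> by s; and that of
    \<open>1 - t\<^sup>2 * s / 2\<close> by the exponential.\<close>
  have cond: "cmod ((CLINT y|density lborel (\<lambda>y. ennreal (q k \<omega> y)). iexp (t * \<zeta> k \<omega> y)) - exp (- (t\<^sup>2 * s / 2))) \<le>
      \<bar>t\<bar> powr (2 + \<delta>) * L + t\<^sup>2 / 2 * \<bar>v k \<omega> - s\<bar> + (t\<^sup>2 * s / 2)\<^sup>2 / 2" if "\<omega> \<in> space M" for k \<omega> t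
  proof -
    let ?A = "CLINT y|density lborel (\<lambda>y. ennreal (q k \<omega> y)). iexp (t * \<zeta> k \<omega> y)"
    interpret Q: prob_space "density lborel (\<lambda>y. ennreal (q k \<omega> y))"
      by (rule prob_space_density_prob_density[OF policy_density[OF that]])
    have "cmod (?A - complex_of_real (1 - t\<^sup>2 * v k \<omega> / 2)) \<le> \<bar>t\<bar> powr (2 + \<delta>) * L"
    proof (cases "good k \<omega>")
      case True
      then have "ais_moment \<eta> (q k \<omega>) \<phi> \<le> ennreal K" by (auto simp: good_def)
      from importance_weight_expansion(1)[OF policy_density[OF that] \<phi> \<eta> this K, of t w] show ?thesis
        using True by (simp add: v_def \<zeta>_def Y_def L_def I_def \<delta>_def)
    next
      case False
      then show ?thesis using L0 Q.prob_space by (simp add: v_def \<zeta>_def)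
    qed
    moreover have "cmod (complex_of_real (1 - t\<^sup>2 * v k \<omega> / 2) - complex_of_real (1 - t\<^sup>2 * s / 2)) =
        t\<^sup>2 / 2 * \<bar>v k \<omega> - s\<bar>"
    proof -
      have "(1 - t\<^sup>2 * v k \<omega> / 2) - (1 - t\<^sup>2 * s / 2) = t\<^sup>2 / 2 * - (v k \<omega> - s)"
        by (simp add: field_simps)
      then show ?thesis
        unfolding of_real_diff[symmetric] norm_of_real by (simp only: abs_mult abs_minus_cancel) simp
    qed
    moreover have "cmod (complex_of_real (1 - t\<^sup>2 * s / 2) - complex_of_real (exp (- (t\<^sup>2 * s / 2)))) \<le>
        (t\<^sup>2 * s / 2)\<^sup>2 / 2"
      unfolding of_real_diff[symmetric] norm_of_real using s
      by (intro exp_minus_quadratic_bound) simp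
    ultimately show ?thesis
      by (smt (verit) norm_diff_triangle_ineq norm_triangle_ineq diff_add_cancel add_diff_eq)
  qed
  \<comment> \<open>The first term pays for undoing the truncation, as two points of the unit circle
    are at distance at most 2. The rest is n times the averaged bound \<open>cond\<close> at
    \<open>t = 1 / sqrt (real n)\<close>; its last part is n (s / (2 n))^2 / 2 = s^2 / (8
    n).\<close>
  define R where "R n = 2 * prob bad + (real n powr - (\<delta> / 2) * L + (\<Sum>k<n. e k) / real n / 2 + s\<^sup>2 / 8 / real n)" for n
  show thesis
  proof
    have "(\<lambda>n. real n powr - (\<delta> / 2)) \<longlonglongrightarrow> 0"
      using \<delta> by (intro tendsto_neg_powr filterlim_real_sequentially) simp
    then have "R \<longlonglongrightarrow> 2 * prob bad + (0 * L + s * prob bad / 2 + 0)"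
      unfolding R_def
      by (intro tendsto_add tendsto_mult tendsto_const tendsto_divide cesaro_mean_tendsto e_lim
          lim_const_over_n) auto
    then show "R \<longlonglongrightarrow> (2 + s / 2) * prob (moments_exceed \<eta> \<phi> K)"
      by (simp add: bad_def algebra_simps)
  next
    fix n :: nat assume n: "0 < n"
    define t where "t = 1 / sqrt (real n)"
    have t2: "t\<^sup>2 = 1 / real n" using n by (simp add: t_def power_divide)
    have tp: "real n * \<bar>t\<bar> powr (2 + \<delta>) = real n powr - (\<delta> / 2)"
    proof -
      have "\<bar>t\<bar> = real n powr - (1 / 2)"
        using n by (simp add: t_def powr_minus powr_half_sqrt field_simps)
      then have "\<bar>t\<bar> powr (2 + \<delta>) = real n powr (- (1 / 2) * (2 + \<delta>))"
        by (simp add: powr_powr)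
      also have "real n * \<dots> = real n powr (1 + - (1 / 2) * (2 + \<delta>))"
        using n by (subst powr_add) simp
      finally show ?thesis by (simp add: field_simps)
    qed
    define S where "S \<omega> = (\<Sum>k<n. \<zeta> k \<omega> (x (Suc k) \<omega>))" for \<omega>
    define S' where "S' \<omega> = (\<Sum>k<n. Y k \<omega> (x (Suc k) \<omega>))" for \<omega>
    have [measurable]: "S \<in> borel_measurable M" "S' \<in> borel_measurable M"
      unfolding S_def S'_def
      by (intro borel_measurable_sum measurable_from_subalg[OF sub measurable_past_sample] \<zeta>_meas Y_meas;
          auto)+
    have "cmod ((CLINT \<omega>|M. iexp (t * S \<omega>)) - exp (- (real n * (t\<^sup>2 * s / 2)))) \<le>
        (\<Sum>k<n. LINT \<omega>|M. cmod ((CLINT y|density lborel (\<lambda>y. ennreal (q k \<omega> y)). iexp (t * \<zeta> k \<omega> y)) -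
          exp (- (t\<^sup>2 * s / 2))))"
      unfolding S_def by (rule char_sum_le_sum_conditional) (use \<zeta>_meas s in auto)
    also have "\<dots> \<le> (\<Sum>k<n. \<bar>t\<bar> powr (2 + \<delta>) * L + t\<^sup>2 / 2 * e k + (t\<^sup>2 * s / 2)\<^sup>2 / 2)"
    proof (rule sum_mono)
      fix k
      have int: "integrable M (\<lambda>\<omega>. \<bar>t\<bar> powr (2 + \<delta>) * L + t\<^sup>2 / 2 * \<bar>v k \<omega> - s\<bar> + (t\<^sup>2 * s / 2)\<^sup>2 / 2)"
        by (intro Bochner_Integration.integrable_add integrable_mult_right e_int integrable_const)
      have meas: "(\<lambda>\<omega>. CLINT y|density lborel (\<lambda>y. ennreal (q k \<omega> y)). iexp (t * \<zeta> k \<omega> y)) \<in> borel_measurable M"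
      proof (rule measurable_from_subalg[OF sub[of k] integral_sample(1)[where B=1]])
        note [measurable] = \<zeta>_meas[of k]
        show "(\<lambda>(\<omega>, y). iexp (t * \<zeta> k \<omega> y)) \<in> borel_measurable (?F k \<Otimes>\<^sub>M borel)" by measurable
      qed simp
      have "(LINT \<omega>|M. cmod ((CLINT y|density lborel (\<lambda>y. ennreal (q k \<omega> y)). iexp (t * \<zeta> k \<omega> y)) -
          exp (- (t\<^sup>2 * s / 2)))) \<le>
          (LINT \<omega>|M. \<bar>t\<bar> powr (2 + \<delta>) * L + t\<^sup>2 / 2 * \<bar>v k \<omega> - s\<bar> + (t\<^sup>2 * s / 2)\<^sup>2 / 2)"
      proof (rule integral_mono)
        show "integrable M (\<lambda>\<omega>. cmod ((CLINT y|density lborel (\<lambda>y. ennreal (q k \<omega> y)). iexp (t * \<zeta> k \<omega> y)) -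
          exp (- (t\<^sup>2 * s / 2))))"
        proof (rule Bochner_Integration.integrable_bound[OF int])
          show "AE \<omega> in M. norm (cmod ((CLINT y|density lborel (\<lambda>y. ennreal (q k \<omega> y)). iexp (t * \<zeta> k \<omega> y)) -
              exp (- (t\<^sup>2 * s / 2)))) \<le>
              norm (\<bar>t\<bar> powr (2 + \<delta>) * L + t\<^sup>2 / 2 * \<bar>v k \<omega> - s\<bar> + (t\<^sup>2 * s / 2)\<^sup>2 / 2)"
            unfolding real_norm_def abs_norm_cancel
            by (intro AE_I2 order_trans[OF cond abs_ge_self])
        qed (use meas in measurable)
      qed (use int cond in auto)
      also have "\<dots> = \<bar>t\<bar> powr (2 + \<delta>) * L + t\<^sup>2 / 2 * e k + (t\<^sup>2 * s / 2)\<^sup>2 / 2"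
        using e_int[of k] by (simp add: e_def prob_space)
      finally show "(LINT \<omega>|M. cmod ((CLINT y|density lborel (\<lambda>y. ennreal (q k \<omega> y)). iexp (t * \<zeta> k \<omega> y)) -
          exp (- (t\<^sup>2 * s / 2)))) \<le> \<bar>t\<bar> powr (2 + \<delta>) * L + t\<^sup>2 / 2 * e k + (t\<^sup>2 * s / 2)\<^sup>2 / 2" .
    qed
    also have "\<dots> = real n * \<bar>t\<bar> powr (2 + \<delta>) * L + t\<^sup>2 / 2 * (\<Sum>k<n. e k) + real n * ((t\<^sup>2 * s / 2)\<^sup>2 / 2)"
      by (simp add: sum.distrib sum_distrib_left)
    also have "\<dots> = real n powr - (\<delta> / 2) * L + (\<Sum>k<n. e k) / real n / 2 + s\<^sup>2 / 8 / real n"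
      unfolding tp t2 using n by (simp add: power2_eq_square field_simps)
    finally have trunc: "cmod ((CLINT \<omega>|M. iexp (t * S \<omega>)) - exp (- (real n * (t\<^sup>2 * s / 2)))) \<le>
        real n powr - (\<delta> / 2) * L + (\<Sum>k<n. e k) / real n / 2 + s\<^sup>2 / 8 / real n" .
    have ints: "integrable M (\<lambda>\<omega>. iexp (t * S \<omega>))" "integrable M (\<lambda>\<omega>. iexp (t * S' \<omega>))"
      by (rule integrable_const_bound[where B=1]; auto)+
    have "cmod ((CLINT \<omega>|M. iexp (t * S' \<omega>)) - (CLINT \<omega>|M. iexp (t * S \<omega>))) =
        cmod (CLINT \<omega>|M. iexp (t * S' \<omega>) - iexp (t * S \<omega>))"
      using ints by simp
    also have "\<dots> \<le> (LINT \<omega>|M. cmod (iexp (t * S' \<omega>) - iexp (t * S \<omega>)))"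
      by (rule integral_norm_bound)
    also have "\<dots> \<le> (LINT \<omega>|M. 2 * indicator bad \<omega>)"
    proof (rule integral_mono)
      show "integrable M (\<lambda>\<omega>. cmod (iexp (t * S' \<omega>) - iexp (t * S \<omega>)))"
        using ints by (intro integrable_norm Bochner_Integration.integrable_diff)
      show "cmod (iexp (t * S' \<omega>) - iexp (t * S \<omega>)) \<le> 2 * indicator bad \<omega>" if "\<omega> \<in> space M" for \<omega>
      proof (cases "\<omega> \<in> bad")
        case True
        then show ?thesis
          using norm_triangle_ineq4[of "iexp (t * S' \<omega>)" "iexp (t * S \<omega>)"] by simp
      next
        case False
        then have "good k \<omega>" for k
          using that by (auto simp: bad_def moments_exceed_def good_def not_less)
        then show ?thesis by (simp add: S_def S'_def \<zeta>_def)
      qed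
      show "integrable M (\<lambda>\<omega>. 2 * indicator bad \<omega> :: real)"
        by (rule integrable_const_bound[where B=2]) (auto simp: indicator_def)
    qed
    also have "\<dots> = 2 * prob bad" by simp
    finally have "cmod ((CLINT \<omega>|M. iexp (t * S' \<omega>)) - (CLINT \<omega>|M. iexp (t * S \<omega>))) \<le> 2 * prob bad" .
    from norm_diff_triangle_le[OF this trunc]
    have "cmod ((CLINT \<omega>|M. iexp (t * S' \<omega>)) - exp (- (real n * (t\<^sup>2 * s / 2)))) \<le> R n"
      by (simp only: R_def)
    moreover have "- (real n * (t\<^sup>2 * s / 2)) = - s / 2" using n by (simp add: t2)
    ultimately have "cmod ((CLINT \<omega>|M. iexp (t * S' \<omega>)) - exp (- s / 2)) \<le> R n"
      by (simp only:)
    then show "cmod ((CLINT \<omega>|M. iexp (1 / sqrt (real n) *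
        (\<Sum>k<n. w \<bullet> ((1 / q k \<omega> (x (Suc k) \<omega>)) *\<^sub>R \<phi> (x (Suc k) \<omega>) - (LINT y|lborel. \<phi> y))))) -
      exp (- s / 2)) \<le> R n"
      unfolding S'_def t_def Y_def I_def .
  qed
qed

text \<open>The order of the limits matters: K is chosen first, so that the limit of R falls below
  \<epsilon>, and only then does n grow.\<close>

lemma char_ais_estimate_tendsto:
  fixes \<phi> :: "real ^ 'd \<Rightarrow> real ^ 'p" and w :: "real ^ 'p"
  assumes \<phi>: "integrable lborel \<phi>" and \<eta>: "0 < \<eta>"
    and moment: "AE \<omega> in M. (SUP j. ais_moment \<eta> (q j \<omega>) \<phi>) < \<infinity>"
    and s: "0 \<le> s" and conv: "AE \<omega> in M. (\<lambda>n. w \<bullet> (ais_variance (q n \<omega>) \<phi> *v w)) \<longlonglongrightarrow> s"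
  shows "(\<lambda>n. CLINT \<omega>|M. iexp (w \<bullet> (sqrt (real n) *\<^sub>R (ais_estimate q x \<phi> n \<omega> - (LINT y|lborel. \<phi> y)))))
    \<longlonglongrightarrow> complex_of_real (exp (- s / 2))"
proof -
  have [measurable]: "\<phi> \<in> borel_measurable borel"
    using \<phi> by (auto dest: borel_measurable_integrable)
  define E where "E n = (CLINT \<omega>|M. iexp (1 / sqrt (real n) *
        (\<Sum>k<n. w \<bullet> ((1 / q k \<omega> (x (Suc k) \<omega>)) *\<^sub>R \<phi> (x (Suc k) \<omega>) - (LINT y|lborel. \<phi> y)))))" for n
  have "E \<longlonglongrightarrow> complex_of_real (exp (- s / 2))"
  proof (rule tendstoI)
    fix \<epsilon> :: real assume \<epsilon>: "0 < \<epsilon>"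
    have "(\<lambda>K. (2 + s / 2) * prob (moments_exceed \<eta> \<phi> (real K))) \<longlonglongrightarrow> (2 + s / 2) * 0"
      by (intro tendsto_mult tendsto_const prob_moments_exceed_tendsto_0 moment) simp
    then have "eventually (\<lambda>K. (2 + s / 2) * prob (moments_exceed \<eta> \<phi> (real K)) < \<epsilon>) sequentially"
      by (rule order_tendstoD) (use \<epsilon> in simp)
    then obtain K :: nat where K: "(2 + s / 2) * prob (moments_exceed \<eta> \<phi> (real K)) < \<epsilon>"
      by (auto simp: eventually_sequentially)
    obtain R where R: "R \<longlonglongrightarrow> (2 + s / 2) * prob (moments_exceed \<eta> \<phi> (real K))"
      and E_le: "\<And>n. 0 < n \<Longrightarrow> cmod (E n - exp (- s / 2)) \<le> R n"
      unfolding E_def by (rule char_ais_estimate_limsup[OF \<phi> \<eta> of_nat_0_le_iff[of K] s conv])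
         (rule that[unfolded E_def])
    have "eventually (\<lambda>n. R n < \<epsilon>) sequentially"
      using R K by (rule order_tendstoD)
    then show "eventually (\<lambda>n. dist (E n) (complex_of_real (exp (- s / 2))) < \<epsilon>) sequentially"
      using eventually_gt_at_top[of 0]
    proof eventually_elim
      case (elim n)
      then show ?case using E_le[of n] by (simp add: dist_norm)
    qed
  qed
  moreover have "eventually (\<lambda>n. E n = (CLINT \<omega>|M. iexp (w \<bullet> (sqrt (real n) *\<^sub>R
      (ais_estimate q x \<phi> n \<omega> - (LINT y|lborel. \<phi> y)))))) sequentially"
    using eventually_gt_at_top[of 0]
  proof eventually_elim
    case (elim n)
    define I where "I = (LINT y|lborel. \<phi> y)"
    have "1 / sqrt (real n) * (\<Sum>k<n. w \<bullet> ((1 / q k \<omega> (x (Suc k) \<omega>)) *\<^sub>R \<phi> (x (Suc k) \<omega>) - I)) =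
        w \<bullet> (sqrt (real n) *\<^sub>R (ais_estimate q x \<phi> n \<omega> - I))" for \<omega>
    proof -
      \<comment> \<open>Index shift: draw \<open>j = Suc k\<close> is made from \<open>q k\<close>,
        so the sum over j from 1 to n becomes a sum over \<open>k < n\<close>.\<close>
      define T where "T = (\<Sum>k<n. (1 / q k \<omega> (x (Suc k) \<omega>)) *\<^sub>R \<phi> (x (Suc k) \<omega>))"
      have "ais_estimate q x \<phi> n \<omega> = (1 / real n) *\<^sub>R T"
        unfolding ais_estimate_def T_def
        by (simp add: sum.atLeast1_atMost_eq)
      moreover have "(\<Sum>k<n. w \<bullet> ((1 / q k \<omega> (x (Suc k) \<omega>)) *\<^sub>R \<phi> (x (Suc k) \<omega>) - I)) =
          w \<bullet> T - real n * (w \<bullet> I)"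
        by (simp add: T_def inner_sum_right inner_diff_right sum_subtractf)
      ultimately show ?thesis
        using elim by (simp only:) (simp add: inner_diff_right field_simps)
    qed
    then show ?case by (simp add: E_def I_def)
  qed
  ultimately show ?thesis
    by (rule Lim_transform_eventually)
qed

end

theorem theorem1:
  fixes M :: "'w measure"
    and alloc :: "nat \<Rightarrow> nat"
    and q :: "nat \<Rightarrow> 'w \<Rightarrow> real ^ 'd \<Rightarrow> real"
    and x :: "nat \<Rightarrow> 'w \<Rightarrow> real ^ 'd"
    and \<phi> :: "real ^ 'd \<Rightarrow> real ^ 'p"
    and V :: "real ^ 'p ^ 'p"
  assumes "adaptive_importance_sampling M alloc q x"
    and "integrable lborel \<phi>"
    and "pos_semidef V"
    and "AE \<omega> in M. (\<lambda>n. ais_variance (q n \<omega>) \<phi>) \<longlonglongrightarrow> V"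
    and "\<exists>\<eta>>0. AE \<omega> in M. (SUP j. ais_moment \<eta> (q j \<omega>) \<phi>) < \<infinity>"
  shows "converges_in_distribution M
           (\<lambda>n \<omega>. sqrt (real n) *\<^sub>R (ais_estimate q x \<phi> n \<omega> - (LINT y|lborel. \<phi> y)))
           (normal_vec 0 V)"
proof -
  interpret adaptive_importance_sampling M alloc q x by fact
  obtain \<eta> where \<eta>: "0 < \<eta>" and moment: "AE \<omega> in M. (SUP j. ais_moment \<eta> (q j \<omega>) \<phi>) < \<infinity>"
    using assms(5) by blast
  let ?X = "\<lambda>n \<omega>. sqrt (real n) *\<^sub>R (ais_estimate q x \<phi> n \<omega> - (LINT y|lborel. \<phi> y))"
  have [measurable]: "\<phi> \<in> borel_measurable borel"
    using assms(2) by (auto dest: borel_measurable_integrable)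
  have X_meas [measurable]: "?X n \<in> borel_measurable M" for n
  proof -
    have "(\<lambda>\<omega>. (1 / q (j - 1) \<omega> (x j \<omega>)) *\<^sub>R \<phi> (x j \<omega>)) \<in> borel_measurable M" if "1 \<le> j" for j
    proof -
      note [measurable] = policy_measurable[of "j - 1"]
      have "(\<lambda>(\<omega>, y). (1 / q (j - 1) \<omega> y) *\<^sub>R \<phi> y) \<in>
          borel_measurable (sample_algebra M x (j - 1) \<Otimes>\<^sub>M borel)"
        by measurable
      from measurable_from_subalg[OF subalgebra_sample_algebra measurable_past_sample[OF this, of j]] that
      show ?thesis by simp
    qed
    then show ?thesis
      unfolding ais_estimate_def
      by (intro borel_measurable_scaleR[OF borel_measurable_const] borel_measurable_diff
          borel_measurable_sum borel_measurable_const) auto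
  qed
  show ?thesis
    unfolding converges_in_distribution_def
  proof (intro allI impI, elim conjE, rule levy_continuity_vec)
    show "prob_space (distr M borel (?X n))" for n
      by (rule prob_space_distr) simp
    show "(\<lambda>n. CLINT y|distr M borel (?X n). iexp (w \<bullet> y)) \<longlonglongrightarrow> (CLINT y|normal_vec 0 V. iexp (w \<bullet> y))" for w
    proof -
      have "AE \<omega> in M. (\<lambda>n. w \<bullet> (ais_variance (q n \<omega>) \<phi> *v w)) \<longlonglongrightarrow> w \<bullet> (V *v w)"
        using assms(4)
      proof eventually_elim
        case (elim \<omega>)
        then show ?case
          unfolding inner_vec_def matrix_vector_mult_def vec_lambda_beta by (auto intro!: tendsto_intros)
      qed
      then have "(\<lambda>n. CLINT \<omega>|M. iexp (w \<bullet> ?X n \<omega>)) \<longlonglongrightarrow> complex_of_real (exp (- (w \<bullet> (V *v w)) / 2))"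
        using assms(3) by (intro char_ais_estimate_tendsto[OF assms(2) \<eta> moment]) (auto simp: pos_semidef_def)
      then show ?thesis
        unfolding char_normal_vec[OF assms(3)] by (subst integral_distr) auto
    qed
  qed (auto simp: prob_space_normal_vec)
qed

end
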